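(* Let $X=N_{\mathbb R}/M'$ be a tropical abelian variety of dimension $n\ge1$, and let $(Q,\ell)$ be a pair of a polarization $Q$ on $X$ of type $(d_1,\dots,d_n)$ and a homomorphism $\ell:M'\to\mathbb R$. Let $\varphi^{(Q,\ell)}:X\to\mathbb{TP}^{D-1}$, $D=d_1\cdots d_n$, be the map given by the tropical theta functions $\vartheta_{b}^{(Q,\ell)}$, with $b$ running through a complete system of representatives of $M/\lambda(M')$. Then: (1) if $d_1\ge3$, then $\varphi^{(Q,\ell)}$ is a homeomorphism onto its image; (2) if $d_1\ge2(n-1)!$, then $\varphi^{(Q,\ell)}$ is unimodular; (3) if $d_1\ge\max\{3,2(n-1)!\}$, then $\varphi^{(Q,\ell)}$ is a faithful embedding.
   Context: $M$ is a free $\mathbb Z$-module of rank $n$, $N=\operatorname{Hom}(M,\mathbb Z)$, $N_{\mathbb R}=\operatorname{Hom}(M,\mathbb R)$ with pairing $\langle\cdot,\cdot\rangle$, $M'\subset N_{\mathbb R}$ a full lattice, $\pi:N_{\mathbb R}\to X=N_{\mathbb R}/M'$ the projection. A polarization on $X$ is a positive-definite symmetric $\mathbb R$-bilinear form $Q:N_{\mathbb R}\times N_{\mathbb R}\to\mathbb R$ with $Q(M'\times N)\subset\mathbb Z$; $X$ is a tropical abelian variety if it has one. The corresponding injective homomorphism $\lambda:M'\to M$ is $\lambda(u')=Q(u',\cdot)|_N$; its $\mathbb R$-extension $\lambda_{\mathbb R}:N_{\mathbb R}=M'_{\mathbb R}\to M_{\mathbb R}$ is an isomorphism. The type $(d_1,\dots,d_n)$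 consists of the positive integers with $d_i\mid d_{i+1}$ such that $\lambda$ is $\mathrm{diag}(d_1,\dots,d_n)$ in suitable $\mathbb Z$-bases of $M'$ and $M$. Let $r\in N_{\mathbb R}$ be the element with $\ell(\cdot)=Q(\cdot,r)$. For $b\in M$, $$\vartheta_b^{(Q,\ell)}(x)=\min_{u'\in M'}\Big(Q(x,\lambda_{\mathbb R}^{-1}(b)+u')+\tfrac12Q(u'+\lambda_{\mathbb R}^{-1}(b)-r,\,u'+\lambda_{\mathbb R}^{-1}(b)-r)\Big),\quad x\in N_{\mathbb R}.$$ It depends only on the class of $b$ in $M/\lambda(M')$ and satisfies $\vartheta_b(x+u')=\vartheta_b(x)-Q(x,u')-\frac12Q(u',u')+\ell(u')$ for $u'\in M'$. Hence for representatives $b_1,\dots,b_D$ of $M/\lambda(M')$ the map $x\mapsto(\vartheta_{b_1}^{(Q,\ell)}(\tilde x):\cdots:\vartheta_{b_D}^{(Q,\ell)}(\tilde x))$, $\tilde x$ any lift of $x$, is well defined from $X$ to $\mathbb R^D/\mathbb R(1,\dots,1)\subset\mathbb{TP}^{D-1}$; up to ordering of coordinates it is independent of choices, and is denoted $\varphi^{(Q,\ell)}$. The target is identified with $\mathbb R^{D-1}$ by subtracting one coordinate. A map $\varphi:X\to\mathbb R^m$ is unimodular if there is a locally finite rational polyhedral decomposition of $N_{\mathbb R}$ (cells cut out by finitely many inequalities $\langle u,x\rangle\ge b$, $u\in M$, $b\in\mathbb R$) on each cell of which $\varphi\circ\pi$ agrees with an affine map whose linear part extends an injective homomorphism $N\to\mathbb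 Z^m$ with torsion-free cokernel. It is a faithful embedding if it is unimodular and a homeomorphism onto its image. *)

theory Defs
  imports "HOL-Analysis.Analysis"
begin

text \<open>
  The space \<open>N\<^sub>\<real>\<close> is a type \<open>'v::euclidean_space\<close> of dimension \<open>n = DIM('v)\<close>; its inner product
  plays no role (only the vector space structure and the standard topology do). The module \<open>M\<close> is a
  full lattice in the dual space \<open>M\<^sub>\<real> = ('v \<Rightarrow>\<^sub>L real)\<close>. Every free module of rank \<open>n\<close> arises this way,
  and evaluation identifies \<open>'v\<close> with \<open>Hom(M, \<real>)\<close> and \<open>dual_lattice M\<close> with \<open>Hom(M, \<int>)\<close>. The pairing
  of \<open>u\<close> and \<open>x\<close> is \<open>blinfun_apply u x\<close>.
\<close>

text \<open>A family indexed by \<open>1, \<dots>, n\<close>, as in the usual numbering of elementary divisors. For a full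
  lattice, \<open>\<int>\<close>-bases are the \<open>\<real>\<close>-bases of the ambient space whose \<open>\<int>\<close>-span is the lattice.\<close>

definition lattice_basis :: "nat \<Rightarrow> (nat \<Rightarrow> 'a::real_vector) \<Rightarrow> 'a set \<Rightarrow> bool" where
  "lattice_basis n e L \<longleftrightarrow>
     inj_on e {1..n} \<and> independent (e ` {1..n}) \<and> span (e ` {1..n}) = UNIV \<and>
     L = {\<Sum>i=1..n. of_int (c i) *\<^sub>R e i | c :: nat \<Rightarrow> int. True}"

definition full_lattice :: "'a::real_vector set \<Rightarrow> bool" where
  "full_lattice L \<longleftrightarrow> (\<exists>n e. lattice_basis n e L)"

definition dual_lattice :: "('v::real_normed_vector \<Rightarrow>\<^sub>L real) set \<Rightarrow> 'v set" where
  "dual_lattice M = {v. \<forall>u\<in>M. blinfun_apply u v \<in> \<int>}"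

definition coset :: "'v::ab_group_add set \<Rightarrow> 'v \<Rightarrow> 'v set" where
  "coset M' x = (\<lambda>u. x + u) ` M'"

definition torus :: "'v::real_normed_vector set \<Rightarrow> 'v set topology" where
  "torus M' = topology (\<lambda>U. U \<subseteq> range (coset M') \<and> open (coset M' -` U))"

lemma openin_torus:
  "openin (torus M') U \<longleftrightarrow> U \<subseteq> range (coset M') \<and> open (coset M' -` U)"
proof -
  have "istopology (\<lambda>U. U \<subseteq> range (coset M') \<and> open (coset M' -` U))"
    unfolding istopology_def by (auto simp: vimage_Union intro!: open_Int open_UN)
  then show ?thesis
    by (simp add: torus_def topology_inverse')
qed

lemma topspace_torus: "topspace (torus M') = range (coset M')"
proof
  show "topspace (torus M') \<subseteq> range (coset M')"
    by (metis openin_torus openin_topspace)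
  have "coset M' -` range (coset M') = UNIV" by auto
  then have "openin (torus M') (range (coset M'))"
    by (simp add: openin_torus)
  then show "range (coset M') \<subseteq> topspace (torus M')"
    by (rule openin_subset)
qed

lemma quotient_map_coset: "quotient_map euclidean (torus M') (coset M')"
  by (auto simp: quotient_map_def topspace_torus openin_torus vimage_def)

text \<open>A bilinear form \<open>Q\<close> on \<open>N\<^sub>\<real>\<close> is given in curried form, so that \<open>blinfun_apply Q\<close> is the map
  \<open>\<lambda>\<^sub>\<real> : N\<^sub>\<real> \<rightarrow> M\<^sub>\<real>\<close>, and its restriction to \<open>M'\<close> is \<open>\<lambda>\<close>.\<close>

definition polarization ::
  "('v::real_normed_vector \<Rightarrow>\<^sub>L real) set \<Rightarrow> 'v set \<Rightarrow> ('v \<Rightarrow>\<^sub>L 'v \<Rightarrow>\<^sub>L real) \<Rightarrow> bool" where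
  "polarization M M' Q \<longleftrightarrow>
     (\<forall>x y. blinfun_apply (blinfun_apply Q x) y = blinfun_apply (blinfun_apply Q y) x) \<and>
     (\<forall>x. x \<noteq> 0 \<longrightarrow> blinfun_apply (blinfun_apply Q x) x > 0) \<and>
     (\<forall>u\<in>M'. \<forall>v\<in>dual_lattice M. blinfun_apply (blinfun_apply Q u) v \<in> \<int>)"

definition polarization_type ::
  "('v::euclidean_space \<Rightarrow>\<^sub>L real) set \<Rightarrow> 'v set \<Rightarrow> ('v \<Rightarrow>\<^sub>L 'v \<Rightarrow>\<^sub>L real) \<Rightarrow> (nat \<Rightarrow> nat) \<Rightarrow> bool" where
  "polarization_type M M' Q d \<longleftrightarrow>
     (\<forall>i\<in>{1..DIM('v)}. d i > 0) \<and>
     (\<forall>i\<in>{1..<DIM('v)}. d i dvd d (Suc i)) \<and>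
     (\<exists>w e. lattice_basis DIM('v) w M' \<and> lattice_basis DIM('v) e M \<and>
        (\<forall>i\<in>{1..DIM('v)}. blinfun_apply Q (w i) = real (d i) *\<^sub>R e i))"

definition theta ::
  "'v::real_normed_vector set \<Rightarrow> ('v \<Rightarrow>\<^sub>L 'v \<Rightarrow>\<^sub>L real) \<Rightarrow> ('v \<Rightarrow> real) \<Rightarrow> ('v \<Rightarrow>\<^sub>L real) \<Rightarrow> 'v \<Rightarrow> real" where
  "theta M' Q l b x =
     (let r = (THE r. \<forall>u\<in>M'. l u = blinfun_apply (blinfun_apply Q u) r);
          c = inv (blinfun_apply Q) b
      in LEAST t. t \<in> (\<lambda>u. blinfun_apply (blinfun_apply Q x) (c + u) +
                 1/2 * blinfun_apply (blinfun_apply Q (u + c - r)) (u + c - r)) ` M')"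

definition complete_reps :: "'a::ab_group_add set \<Rightarrow> 'a set \<Rightarrow> nat \<Rightarrow> (nat \<Rightarrow> 'a) \<Rightarrow> bool" where
  "complete_reps M L D b \<longleftrightarrow>
     (\<forall>i<D. b i \<in> M) \<and> (\<forall>m\<in>M. \<exists>!i. i < D \<and> m - b i \<in> L)"

text \<open>\<open>\<real>\<^sup>D/\<real>(1,\<dots>,1)\<close> is identified with \<open>\<real>\<^bsup>D-1\<^esup>\<close> (sequences vanishing from index \<open>D-1\<close> on, as in
  \<^const>\<open>Euclidean_space\<close>) by subtracting the last of the coordinates \<open>0, \<dots>, D-1\<close>. The lifts of a
  point of the torus are its elements as a coset.\<close>

definition theta_map ::
  "'v::real_normed_vector set \<Rightarrow> ('v \<Rightarrow>\<^sub>L 'v \<Rightarrow>\<^sub>L real) \<Rightarrow> ('v \<Rightarrow> real) \<Rightarrow>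
   nat \<Rightarrow> (nat \<Rightarrow> ('v \<Rightarrow>\<^sub>L real)) \<Rightarrow> 'v set \<Rightarrow> (nat \<Rightarrow> real)" where
  "theta_map M' Q l D b p =
     (let x = (SOME x. x \<in> p)
      in (\<lambda>i. if i < D - 1 then theta M' Q l (b i) x - theta M' Q l (b (D - 1)) x else 0))"

definition rational_polyhedron ::
  "('v::real_normed_vector \<Rightarrow>\<^sub>L real) set \<Rightarrow> 'v set \<Rightarrow> bool" where
  "rational_polyhedron M P \<longleftrightarrow>
     (\<exists>H. finite H \<and> H \<subseteq> M \<times> UNIV \<and> P = {x. \<forall>(u, a)\<in>H. blinfun_apply u x \<ge> a})"

definition polyhedral_decomposition ::
  "('v::real_normed_vector \<Rightarrow>\<^sub>L real) set \<Rightarrow> 'v set set \<Rightarrow> bool" where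
  "polyhedral_decomposition M \<C> \<longleftrightarrow>
     (\<forall>P\<in>\<C>. rational_polyhedron M P \<and> P \<noteq> {}) \<and>
     \<Union>\<C> = UNIV \<and>
     (\<forall>P\<in>\<C>. \<forall>F. F face_of P \<and> F \<noteq> {} \<longrightarrow> F \<in> \<C>) \<and>
     (\<forall>P\<in>\<C>. \<forall>P'\<in>\<C>. (P \<inter> P') face_of P \<and> (P \<inter> P') face_of P') \<and>
     locally_finite_in euclidean \<C>"

definition integer_points :: "nat \<Rightarrow> (nat \<Rightarrow> real) set" where
  "integer_points m = {y \<in> topspace (Euclidean_space m). \<forall>i. y i \<in> \<int>}"

text \<open>The last conjunct says that the cokernel of \<open>A\<close> restricted to \<open>N\<close> is torsion-free.\<close>

definition unimodular_linear ::
  "('v::real_normed_vector \<Rightarrow>\<^sub>L real) set \<Rightarrow> nat \<Rightarrow> ('v \<Rightarrow> nat \<Rightarrow> real) \<Rightarrow> bool" where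
  "unimodular_linear M m A \<longleftrightarrow>
     (\<forall>i. linear (\<lambda>x. A x i)) \<and>
     A ` dual_lattice M \<subseteq> integer_points m \<and>
     inj_on A (dual_lattice M) \<and>
     (\<forall>y\<in>integer_points m. \<forall>k::int. k \<noteq> 0 \<and> (\<lambda>i. of_int k * y i) \<in> A ` dual_lattice M
        \<longrightarrow> y \<in> A ` dual_lattice M)"

definition unimodular ::
  "('v::real_normed_vector \<Rightarrow>\<^sub>L real) set \<Rightarrow> 'v set \<Rightarrow> nat \<Rightarrow> ('v set \<Rightarrow> nat \<Rightarrow> real) \<Rightarrow> bool" where
  "unimodular M M' m \<phi> \<longleftrightarrow>
     (\<exists>\<C>. polyhedral_decomposition M \<C> \<and>
        (\<forall>P\<in>\<C>. \<exists>A c. unimodular_linear M m A \<and>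
           (\<forall>x\<in>P. \<phi> (coset M' x) = (\<lambda>i. A x i + c i))))"

definition faithful_embedding ::
  "('v::real_normed_vector \<Rightarrow>\<^sub>L real) set \<Rightarrow> 'v set \<Rightarrow> nat \<Rightarrow> ('v set \<Rightarrow> nat \<Rightarrow> real) \<Rightarrow> bool" where
  "faithful_embedding M M' m \<phi> \<longleftrightarrow>
     unimodular M M' m \<phi> \<and> embedding_map (torus M') (Euclidean_space m) \<phi>"

end

theory Submission
  imports Defs
begin

text \<open>
  Let \<open>L \<supseteq> M'\<close> be the preimage of \<open>M\<close> under \<open>\<lambda>\<^sub>\<real>\<close> and measure lengths with \<open>Q\<close>. Up to a summand independent
  of \<open>b\<close>, the value of \<open>\<vartheta>\<^sub>b\<close> at \<open>x\<close> is half the squared distance from \<open>y = r - x\<close> to the class of \<open>b\<close> in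
  \<open>L / M'\<close>. Hence \<open>\<phi>\<close> is affine on the cells on which a choice of nearest points in all classes stays
  valid, and its linear part there is unimodular iff the differences of these points generate \<open>L\<close>.

  Let \<open>p\<close> be a point of \<open>L\<close> nearest to \<open>y\<close>. Since \<open>M' \<subseteq> d\<^sub>1 L\<close>, if \<open>d\<^sub>1 \<ge> 3\<close> then \<open>p + f\<close> is nearest to \<open>y\<close> in its
  class for every Voronoi relevant vector \<open>f\<close> of \<open>L\<close>. Relevant vectors generate \<open>L\<close>, so the
  theta values at \<open>x\<close> determine \<open>y - p\<close>, which gives injectivity; and \<open>p + f\<close> or \<open>p - f\<close> is the only
  nearest point of its class, which gives unimodularity. The bound \<open>d\<^sub>1 \<ge> 2 (n - 1)!\<close> yields \<open>d\<^sub>1 \<ge> 3\<close>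
  unless \<open>n \<le> 2\<close>, where \<open>d\<^sub>1 \<ge> 2\<close> suffices: the vertices of a Delaunay triangle containing \<open>y\<close> are
  nearest points and their differences generate \<open>L\<close>.
\<close>

section \<open>Lattices in Euclidean space and nearest points of their cosets\<close>

lemma finite_has_minimizer:
  fixes f :: "'a \<Rightarrow> 'b::linorder"
  assumes "finite F" "F \<noteq> {}"
  obtains z where "z \<in> F" "\<And>w. w \<in> F \<Longrightarrow> f z \<le> f w"
proof -
  have "Min (f ` F) \<in> f ` F" using assms by simp
  then obtain z where "z \<in> F" "f z = Min (f ` F)" by auto
  then show ?thesis using that[of z] assms(1) by simp
qed

section \<open>Positive definite symmetric bilinear forms\<close>

locale posdef_form =
  fixes B :: "'v::euclidean_space \<Rightarrow> 'v \<Rightarrow> real"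
  assumes bilinear: "bilinear B"
    and sym: "B x y = B y x"
    and pos: "x \<noteq> 0 \<Longrightarrow> B x x > 0"
begin

abbreviation q :: "'v \<Rightarrow> real" where "q x \<equiv> B x x"

lemmas form_simps =
  bilinear_ladd[OF bilinear] bilinear_radd[OF bilinear]
  bilinear_lsub[OF bilinear] bilinear_rsub[OF bilinear]
  bilinear_lmul[OF bilinear] bilinear_rmul[OF bilinear]
  bilinear_lneg[OF bilinear] bilinear_rneg[OF bilinear]
  bilinear_lzero[OF bilinear] bilinear_rzero[OF bilinear]

lemma q_nonneg: "0 \<le> q x"
  using pos[of x] by (cases "x = 0") (auto simp: form_simps)

lemma q_eq_0_iff: "q x = 0 \<longleftrightarrow> x = 0"
  using pos[of x] by (cases "x = 0") (auto simp: form_simps)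

lemma q_add: "q (x + y) = q x + 2 * B x y + q y"
  using sym[of y x] by (simp add: form_simps)

lemma q_diff: "q (x - y) = q x - 2 * B x y + q y"
  using sym[of y x] by (simp add: form_simps)

lemma q_minus: "q (- x) = q x"
  by (simp add: form_simps)

lemma q_minus_commute: "q (x - y) = q (y - x)"
  using q_minus[of "x - y"] by simp

lemma q_scaleR: "q (t *\<^sub>R x) = t^2 * q x"
  by (simp add: form_simps power2_eq_square)

lemma q_parallelogram: "q (x + y) \<le> 2 * q x + 2 * q y"
  using q_nonneg[of "x - y"] by (simp add: q_add q_diff)

lemma bounded_bilinear_form: "bounded_bilinear B"
  using bilinear by (simp add: bilinear_conv_bounded_bilinear)

lemma continuous_on_q: "continuous_on S q"
  by (intro bounded_bilinear.continuous_on[OF bounded_bilinear_form] continuous_on_id)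

text \<open>By homogeneity it suffices that \<open>q\<close> has a positive minimum on the compact
  unit sphere.\<close>

lemma q_coercive: "\<exists>c>0. \<forall>x. c * (norm x)\<^sup>2 \<le> q x"
proof -
  have "sphere (0::'v) 1 \<noteq> {}"
    by simp
  then obtain s where s: "s \<in> sphere (0::'v) 1" and min: "\<And>x. x \<in> sphere 0 1 \<Longrightarrow> q s \<le> q x"
    using continuous_attains_inf[OF compact_sphere _ continuous_on_q] by metis
  have "q s > 0"
    using s by (intro pos) auto
  moreover have "q s * (norm x)\<^sup>2 \<le> q x" for x
  proof (cases "x = 0")
    case False
    have "q s \<le> q ((1 / norm x) *\<^sub>R x)"
      using False by (intro min) simp
    also have "\<dots> = q x / (norm x)\<^sup>2"
      unfolding q_scaleR by (simp add: power_divide)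
    finally show ?thesis
      using False by (simp add: field_simps)
  qed (simp add: form_simps)
  ultimately show ?thesis by blast
qed

lemma bounded_q_le: "bounded {x. q x \<le> R}"
proof -
  obtain c where c: "c > 0" "\<And>x. c * (norm x)\<^sup>2 \<le> q x"
    using q_coercive by blast
  have "norm x \<le> sqrt (R / c)" if "q x \<le> R" for x
  proof (rule real_le_rsqrt)
    have "c * (norm x)\<^sup>2 \<le> R" using c(2)[of x] that by linarith
    then show "(norm x)\<^sup>2 \<le> R / c" using c(1) by (simp add: field_simps)
  qed
  then show ?thesis
    by (auto simp: bounded_iff)
qed

end

section \<open>Additive subgroups and generation by differences\<close>

definition additive_subgroup :: "'a::ab_group_add set \<Rightarrow> bool" where
  "additive_subgroup H \<longleftrightarrow> 0 \<in> H \<and> (\<forall>a\<in>H. \<forall>b\<in>H. a - b \<in> H)"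

lemma
  assumes "additive_subgroup H"
  shows additive_subgroup_zero: "0 \<in> H"
    and additive_subgroup_diff: "a \<in> H \<Longrightarrow> b \<in> H \<Longrightarrow> a - b \<in> H"
    and additive_subgroup_minus: "a \<in> H \<Longrightarrow> - a \<in> H"
    and additive_subgroup_add: "a \<in> H \<Longrightarrow> b \<in> H \<Longrightarrow> a + b \<in> H"
proof -
  show z: "0 \<in> H" and d: "\<And>a b. a \<in> H \<Longrightarrow> b \<in> H \<Longrightarrow> a - b \<in> H"
    using assms by (auto simp: additive_subgroup_def)
  show m: "- a \<in> H" if "a \<in> H" for a
    using d[OF z that] by simp
  show "a + b \<in> H" if "a \<in> H" "b \<in> H" for a b
    using d[OF that(1) m[OF that(2)]] by simp
qed

lemma additive_subgroup_of_nat: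
  assumes "additive_subgroup (H :: 'a::real_vector set)" "a \<in> H"
  shows "of_nat k *\<^sub>R a \<in> H"
  by (induction k) (use assms additive_subgroup_zero additive_subgroup_add in \<open>auto simp: scaleR_left_distrib\<close>)

lemma additive_subgroup_of_int:
  assumes "additive_subgroup (H :: 'a::real_vector set)" "a \<in> H"
  shows "of_int k *\<^sub>R a \<in> H"
proof (cases k)
  case (nonneg n)
  then show ?thesis using additive_subgroup_of_nat[OF assms, of n] by simp
next
  case (neg n)
  then show ?thesis
    using additive_subgroup_minus[OF assms(1) additive_subgroup_of_nat[OF assms, of "Suc n"]]
    by (metis neg of_int_minus of_int_of_nat_eq scaleR_minus_left)
qed

text \<open>Differences are used because the coordinates of the theta map are differences of theta
  functions, whose linear parts are differences of nearest points.\<close>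

definition generates :: "'a::ab_group_add set \<Rightarrow> 'a set \<Rightarrow> bool" where
  "generates S L \<longleftrightarrow> (\<forall>H. additive_subgroup H \<and> (\<forall>p\<in>S. \<forall>p'\<in>S. p - p' \<in> H) \<longrightarrow> L \<subseteq> H)"

text \<open>Instead of bases, the locale keeps what the metric arguments use: \<open>L\<close> is
  discrete and spanning, and every point lies within a bounded distance of
  \<open>L'\<close>.\<close>

locale lattice_pair = posdef_form B for B :: "'v::euclidean_space \<Rightarrow> 'v \<Rightarrow> real" +
  fixes L L' :: "'v set"
  assumes subgroup_L: "additive_subgroup L"
    and subgroup_L': "additive_subgroup L'"
    and L'_subset: "L' \<subseteq> L"
    and finite_L: "finite {a \<in> L. q a \<le> R}"
    and span_L: "span L = UNIV"
    and cobounded: "\<exists>R. \<forall>x. \<exists>m\<in>L'. q (x - m) \<le> R"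
begin

lemmas L_zero = additive_subgroup_zero[OF subgroup_L]
lemmas L_add = additive_subgroup_add[OF subgroup_L]
lemmas L_diff = additive_subgroup_diff[OF subgroup_L]
lemmas L_minus = additive_subgroup_minus[OF subgroup_L]
lemmas L'_zero = additive_subgroup_zero[OF subgroup_L']
lemmas L'_add = additive_subgroup_add[OF subgroup_L']
lemmas L'_diff = additive_subgroup_diff[OF subgroup_L']
lemmas L'_minus = additive_subgroup_minus[OF subgroup_L']

lemma finite_L_near: "finite {a \<in> L. q (a - y) \<le> R}"
proof (rule finite_subset[OF _ finite_L[of "2 * R + 2 * q y"]])
  have "q a \<le> 2 * R + 2 * q y" if "q (a - y) \<le> R" for a
    using q_parallelogram[of "a - y" y] that by simp
  then show "{a \<in> L. q (a - y) \<le> R} \<subseteq> {a \<in> L. q a \<le> 2 * R + 2 * q y}"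
    by auto
qed

lemma nearest_exists:
  assumes "A \<subseteq> L" "A \<noteq> {}"
  obtains p where "p \<in> A" "\<And>p'. p' \<in> A \<Longrightarrow> q (p - y) \<le> q (p' - y)"
proof -
  obtain p1 where p1: "p1 \<in> A" using assms by blast
  let ?F = "{a \<in> A. q (a - y) \<le> q (p1 - y)}"
  have "finite ?F"
    by (rule finite_subset[OF _ finite_L_near[of y "q (p1 - y)"]]) (use assms in auto)
  moreover have "?F \<noteq> {}" using p1 by auto
  ultimately obtain p where p: "p \<in> ?F" "\<And>p'. p' \<in> ?F \<Longrightarrow> q (p - y) \<le> q (p' - y)"
    by (rule finite_has_minimizer[where f = "\<lambda>a. q (a - y)"]) (rule that)
  show ?thesis
  proof (rule that[of p])
    show "p \<in> A" using p by blast
    show "q (p - y) \<le> q (p' - y)" if "p' \<in> A" for p'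
      using p(1) p(2)[of p'] that by (cases "q (p' - y) \<le> q (p1 - y)") auto
  qed
qed

text \<open>Only finitely many lattice vectors are shorter than a given one, so induction on length
  is sound although \<open>q\<close> takes real values.\<close>

lemma lattice_induct [consumes 1, case_names less]:
  assumes "a \<in> L" and step: "\<And>a. a \<in> L \<Longrightarrow> (\<And>b. b \<in> L \<Longrightarrow> q b < q a \<Longrightarrow> P b) \<Longrightarrow> P a"
  shows "P a"
  using assms(1)
proof (induction "card {b \<in> L. q b < q a}" arbitrary: a rule: less_induct)
  case less
  show ?case
  proof (rule step[OF less.prems])
    fix b assume b: "b \<in> L" "q b < q a"
    have "finite {b \<in> L. q b < q a}"
      by (rule finite_subset[OF _ finite_L[of "q a"]]) auto
    moreover have "{c \<in> L. q c < q b} \<subset> {b \<in> L. q b < q a}"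
      using b by force
    ultimately show "P b"
      using b by (intro less.hyps psubset_card_mono)
  qed
qed

text \<open>Voronoi's relevant vectors: for \<open>g \<in> L\<close> the last condition says that \<open>f + 2g\<close> is strictly
  longer than \<open>f\<close> unless it is \<open>\<plusminus>f\<close>.\<close>

definition relevant :: "'v \<Rightarrow> bool" where
  "relevant f \<longleftrightarrow> f \<in> L \<and> f \<noteq> 0 \<and> (\<forall>g\<in>L. g \<noteq> 0 \<longrightarrow> g \<noteq> - f \<longrightarrow> 0 < q g + B g f)"

lemma relevant_nonneg: "relevant f \<Longrightarrow> g \<in> L \<Longrightarrow> 0 \<le> q g + B g f"
  unfolding relevant_def by (cases "g = 0"; cases "g = - f") (auto simp: form_simps less_imp_le)

text \<open>If \<open>a\<close> is nonzero and not relevant, a witness \<open>g\<close> with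
  \<open>q g + B g a \<le> 0\<close> makes both \<open>g\<close> and \<open>a + g\<close> strictly
  shorter than \<open>a\<close>, and \<open>a = (a + g) - g\<close>.\<close>

lemma relevant_generate:
  assumes H: "additive_subgroup H" and rel: "\<And>f. relevant f \<Longrightarrow> f \<in> H"
  shows "L \<subseteq> H"
proof
  fix a assume "a \<in> L"
  then show "a \<in> H"
  proof (induction rule: lattice_induct)
    case (less a)
    show ?case
    proof (cases "a = 0 \<or> relevant a")
      case True
      then show ?thesis using rel additive_subgroup_zero[OF H] by blast
    next
      case False
      then obtain g where g: "g \<in> L" "g \<noteq> 0" "g \<noteq> - a" "q g + B g a \<le> 0"
        using less.hyps unfolding relevant_def by force
      have "a + g \<noteq> 0" using g(3) by (metis add_eq_0_iff2 minus_minus)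
      have "q (a + g) = q a - q g + 2 * (q g + B g a)"
        using sym[of a g] by (simp add: q_add)
      then have "q (a + g) < q a" "q g < q a"
        using pos[OF g(2)] pos[OF \<open>a + g \<noteq> 0\<close>] g(4) by argo+
      then have "a + g \<in> H" "g \<in> H"
        using less.IH less.hyps g(1) L_add by blast+
      from additive_subgroup_diff[OF H this] show ?thesis by simp
    qed
  qed
qed

text \<open>Competitors of \<open>p\<close> come only from its own class \<open>p + L'\<close>, so
  this set meets every class of \<open>L\<close> modulo \<open>L'\<close>, possibly in several
  points.\<close>

definition nearest :: "'v \<Rightarrow> 'v set" where
  "nearest y = {p \<in> L. \<forall>m\<in>L'. q (p - y) \<le> q (p + m - y)}"

lemma nearestD: "p \<in> nearest y \<Longrightarrow> p' - p \<in> L' \<Longrightarrow> q (p - y) \<le> q (p' - y)"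
  unfolding nearest_def by force

lemma nearest_in_class:
  assumes "a \<in> L"
  obtains p where "p \<in> nearest y" "p - a \<in> L'"
proof -
  have "(+) a ` L' \<subseteq> L" "(+) a ` L' \<noteq> {}"
    using assms L'_subset L'_zero by (auto intro!: L_add)
  then obtain p where p: "p \<in> (+) a ` L'" "\<And>p'. p' \<in> (+) a ` L' \<Longrightarrow> q (p - y) \<le> q (p' - y)"
    using nearest_exists by metis
  then obtain m where m: "m \<in> L'" "p = a + m" by blast
  have "p + k \<in> (+) a ` L'" if "k \<in> L'" for k
    using L'_add[OF m(1) that] m(2) by (metis add.assoc imageI)
  then have "p \<in> nearest y"
    unfolding nearest_def using p m assms L'_subset by (auto intro!: L_add)
  then show ?thesis using that m by auto
qed

text \<open>Coboundedness of \<open>L'\<close> bounds the distance from \<open>z\<close> to its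
  nearest point in any class, uniformly in the class. Local finiteness of the cells needs one
  \<open>F\<close> for all \<open>z\<close> near \<open>y\<close>.\<close>

lemma finite_nearest: "\<exists>F. finite F \<and> F \<subseteq> L \<and> (\<forall>z. q (z - y) \<le> R \<longrightarrow> nearest z \<subseteq> F)"
proof -
  obtain K where K: "\<And>x. \<exists>m\<in>L'. q (x - m) \<le> K" using cobounded by blast
  have "q (p - y) \<le> 2 * K + 2 * R" if "q (z - y) \<le> R" "p \<in> nearest z" for p z
  proof -
    obtain m where m: "m \<in> L'" "q ((p - z) - m) \<le> K" using K by blast
    have "q (p - z) \<le> q (p - m - z)"
      using nearestD[OF that(2), of "p - m"] L'_minus[OF m(1)] by simp
    then have "q (p - z) \<le> K" using m(2) by (simp add: algebra_simps)
    then show ?thesis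
      using q_parallelogram[of "p - z" "z - y"] that(1) by simp
  qed
  then show ?thesis
    by (intro exI[of _ "{a \<in> L. q (a - y) \<le> 2 * K + 2 * R}"])
       (auto simp: finite_L_near nearest_def)
qed

lemma finite_nearest_point: "finite (nearest y)"
  using finite_nearest[of y 0] by (auto intro: finite_subset simp: form_simps)

text \<open>Voronoi cells of \<open>L'\<close> are polyhedra: with \<open>m = f + 2k\<close> and \<open>f\<close> short, the inequality for \<open>m\<close>
  follows from those for the shorter vectors \<open>k\<close> and \<open>f + k\<close>.\<close>

lemma finite_voronoi:
  "\<exists>F. finite F \<and> F \<subseteq> L' \<and> (\<forall>w. (\<forall>m\<in>F. 0 \<le> q m + 2 * B m w) \<longrightarrow> (\<forall>m\<in>L'. 0 \<le> q m + 2 * B m w))"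
proof -
  obtain K where K: "\<And>x. \<exists>m\<in>L'. q (x - m) \<le> K" using cobounded by blast
  let ?F = "{m \<in> L'. q m \<le> 4 * K}"
  have "0 \<le> q m + 2 * B m w" if F: "\<forall>m\<in>?F. 0 \<le> q m + 2 * B m w" and m: "m \<in> L'" for m w
  proof -
    have "m \<in> L" using m L'_subset by blast
    then show ?thesis
      using m
    proof (induction m rule: lattice_induct)
      case (less m)
      show ?case
      proof (cases "q m \<le> 4 * K")
        case False
        \<comment> \<open>Rounding half of \<open>m\<close> to \<open>L'\<close> makes
          \<open>m - 2k\<close> shorter than \<open>m\<close>; the parallelogram law then gives
          \<open>q (m - k) + q k < q m\<close>.\<close>
        obtain k where k: "k \<in> L'" "q ((1/2) *\<^sub>R m - k) \<le> K" using K by blast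
        have "q (m - 2 *\<^sub>R k) = 4 * q ((1/2) *\<^sub>R m - k)"
          by (simp add: form_simps sym field_simps)
        then have "q (m - 2 *\<^sub>R k) < q m" using k False by linarith
        then have le: "q (m - k) + q k < q m"
          by (simp add: form_simps sym field_simps)
        have mk: "m - k \<in> L'" using less.prems k L'_diff by blast
        have "q (m - k) < q m" "q k < q m"
          using le q_nonneg[of k] q_nonneg[of "m - k"] by linarith+
        then have "0 \<le> q (m - k) + 2 * B (m - k) w" "0 \<le> q k + 2 * B k w"
          using less.IH mk k L'_subset by blast+
        then show ?thesis using le by (simp add: form_simps)
      qed (use F less.prems in auto)
    qed
  qed
  moreover have "finite ?F"
    by (rule finite_subset[OF _ finite_L[of "4 * K"]]) (use L'_subset in auto)
  ultimately show ?thesis by (intro exI[of _ ?F]) auto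
qed

text \<open>With \<open>p\<close> closest to \<open>y\<close> in all of \<open>L\<close>, the three brackets are nonnegative as soon as \<open>f\<close> is a
  shortest vector of \<open>f + 2L\<close>.\<close>

lemma q_shift_expand:
  "q (p + f + d *\<^sub>R g - y) - q (p + f - y) =
     d * ((d - 3) * q g + 2 * (q g + B g f) + (q (p + g - y) - q (p - y)))"
  by (simp only: form_simps sym) (simp add: algebra_simps)

lemma add_relevant_nearest:
  assumes L': "\<And>m. m \<in> L' \<Longrightarrow> \<exists>g\<in>L. m = d *\<^sub>R g" and d: "d \<ge> 3"
    and p: "p \<in> L" "\<And>a. a \<in> L \<Longrightarrow> q (p - y) \<le> q (a - y)" and f: "relevant f"
  shows "p + f \<in> nearest y"
  unfolding nearest_def
proof safe
  show "p + f \<in> L" using p f by (auto simp: relevant_def intro: L_add)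
  fix m assume "m \<in> L'"
  then obtain g where g: "g \<in> L" "m = d *\<^sub>R g" using L' by blast
  have "0 \<le> (d - 3) * q g" "0 \<le> q g + B g f" "0 \<le> q (p + g - y) - q (p - y)"
    using relevant_nonneg[OF f g(1)] p(2)[OF L_add[OF p(1) g(1)]] d q_nonneg[of g] by simp_all
  then have "0 \<le> d * ((d - 3) * q g + 2 * (q g + B g f) + (q (p + g - y) - q (p - y)))"
    using d by (intro mult_nonneg_nonneg[of d]) argo+
  then show "q (p + f - y) \<le> q (p + f + m - y)"
    unfolding g(2) q_shift_expand[symmetric] by simp
qed

text \<open>Since squared distances to the classes agree up to the constant \<open>C\<close>, a
  class closest to \<open>y\<close> is also closest to \<open>y'\<close>. Adding a relevant vector
  to the nearest points \<open>p\<close> and \<open>p'\<close> reveals its pairings with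
  \<open>p - y\<close> and \<open>p' - y'\<close>; these agree, and relevant vectors span.\<close>

lemma nearest_separates:
  assumes L': "\<And>m. m \<in> L' \<Longrightarrow> \<exists>g\<in>L. m = d *\<^sub>R g" and d: "d \<ge> 3"
    and C: "\<And>p p'. p \<in> nearest y \<Longrightarrow> p' \<in> nearest y' \<Longrightarrow> p - p' \<in> L' \<Longrightarrow> q (p - y) - q (p' - y') = C"
  shows "y - y' \<in> L'"
proof -
  obtain p where p: "p \<in> L" "\<And>a. a \<in> L \<Longrightarrow> q (p - y) \<le> q (a - y)"
    using nearest_exists[of L] L_zero by blast
  have pn: "p \<in> nearest y"
    unfolding nearest_def using p L'_subset L_add by blast
  obtain p' where p': "p' \<in> nearest y'" "p' - p \<in> L'"
    using nearest_in_class[OF p(1)] by blast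
  have pp': "p - p' \<in> L'" using L'_minus[OF p'(2)] by simp
  have p'L: "p' \<in> L" using p' by (simp add: nearest_def)
  have C0: "q (p - y) - q (p' - y') = C" by (rule C[OF pn p'(1) pp'])
  \<comment> \<open>\<open>a1\<close> and \<open>a2\<close> are nearest to \<open>y'\<close> and
    \<open>y\<close> in the class of \<open>a\<close>; comparison through \<open>C\<close> transfers
    the minimality of \<open>p\<close> over \<open>L\<close> to \<open>p'\<close>.\<close>
  have min': "q (p' - y') \<le> q (a - y')" if a: "a \<in> L" for a
  proof -
    obtain a1 where a1: "a1 \<in> nearest y'" "a1 - a \<in> L'"
      using nearest_in_class[OF a] by blast
    then have "a1 \<in> L" by (simp add: nearest_def)
    then obtain a2 where a2: "a2 \<in> nearest y" "a2 - a1 \<in> L'"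
      using nearest_in_class by blast
    have "q (a1 - y') \<le> q (a - y')"
      using nearestD[OF a1(1), of a] L'_minus[OF a1(2)] by simp
    moreover have "q (a2 - y) - q (a1 - y') = C" by (rule C[OF a2(1) a1(1) a2(2)])
    moreover have "q (p - y) \<le> q (a2 - y)" using p(2) a2(1) by (simp add: nearest_def)
    ultimately show ?thesis using C0 by linarith
  qed
  define w where "w = (y - p) - (y' - p')"
  let ?H = "{f. B f w = 0}"
  have H: "additive_subgroup ?H"
    by (auto simp: additive_subgroup_def form_simps)
  have "L \<subseteq> ?H"
  proof (rule relevant_generate[OF H])
    fix f assume f: "relevant f"
    have "p + f \<in> nearest y" "p' + f \<in> nearest y'"
      using add_relevant_nearest[OF L' d _ _ f] p p'L min' by blast+
    then have "q (p + f - y) - q (p' + f - y') = C"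
      using C pp' by simp
    then show "f \<in> ?H"
      using C0 by (simp add: w_def form_simps sym)
  qed
  moreover have "subspace ?H"
    by (auto simp: subspace_def form_simps)
  ultimately have "w \<in> ?H"
    using span_L span_minimal[of L ?H] by blast
  then have "y - y' = p - p'"
    using q_eq_0_iff[of w] by (simp add: w_def algebra_simps)
  then show ?thesis using pp' by simp
qed

text \<open>\<open>S\<close> may choose any nearest points as long as it meets every class. If the
  choice in the class of \<open>p + f\<close> is not \<open>p + f\<close>, all terms of
  \<open>q_shift_expand\<close> vanish, which forces \<open>g = - f\<close> and a tie between
  \<open>p - f\<close> and \<open>p\<close>. This cannot happen for both \<open>f\<close> and
  \<open>- f\<close>.\<close>

lemma nearest_generates:
  assumes L': "\<And>m. m \<in> L' \<Longrightarrow> \<exists>g\<in>L. m = d *\<^sub>R g" and d: "d \<ge> 3"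
    and S: "S \<subseteq> nearest y" "\<And>a. a \<in> L \<Longrightarrow> \<exists>p\<in>S. p - a \<in> L'"
  shows "generates S L"
  unfolding generates_def
proof safe
  fix H a assume H: "additive_subgroup H" and SH: "\<forall>p\<in>S. \<forall>p'\<in>S. p - p' \<in> H" and "a \<in> L"
  obtain p0 where p0: "p0 \<in> L" "\<And>a. a \<in> L \<Longrightarrow> q (p0 - y) \<le> q (a - y)"
    using nearest_exists[of L] L_zero by blast
  obtain p where p: "p \<in> S" "p - p0 \<in> L'" using S(2) p0(1) by blast
  have pL: "p \<in> L" using p S by (auto simp: nearest_def)
  have "q (p - y) \<le> q (p0 - y)"
    using nearestD[of p y p0] p S L'_minus[OF p(2)] by auto
  then have min: "q (p - y) \<le> q (a - y)" if "a \<in> L" for a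
    using p0(2)[OF that] by linarith
  have tie: "(q (p + - f - y) = q (p - y)) \<or> f \<in> H" if f: "relevant f" for f
  proof -
    have fL: "f \<in> L" using f by (simp add: relevant_def)
    obtain s where s: "s \<in> S" "s - (p + f) \<in> L'" using S(2) L_add[OF pL fL] by blast
    then obtain g where g: "g \<in> L" "s = p + f + d *\<^sub>R g" using L' by (metis add.commute diff_add_cancel)
    have "q (s - y) \<le> q (p + f - y)"
      using nearestD[of s y "p + f"] s S L'_minus[OF s(2)] by auto
    then have "d * ((d - 3) * q g + 2 * (q g + B g f) + (q (p + g - y) - q (p - y))) \<le> 0"
      unfolding g(2) q_shift_expand[symmetric] by simp
    then have le: "(d - 3) * q g + 2 * (q g + B g f) + (q (p + g - y) - q (p - y)) \<le> 0"
      using d by (simp add: mult_le_0_iff)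
    have nn: "0 \<le> (d - 3) * q g" "0 \<le> q g + B g f" "0 \<le> q (p + g - y) - q (p - y)"
      using relevant_nonneg[OF f g(1)] min[OF L_add[OF pL g(1)]] d q_nonneg[of g] by auto
    have "q g + B g f \<le> 0" using le nn by argo
    then consider "g = 0" | "g = - f" using f g(1) unfolding relevant_def by force
    then show ?thesis
    proof cases
      case 1
      then have "s - p = f" using g by simp
      then show ?thesis using SH s p by blast
    next
      case 2
      then show ?thesis using le nn by simp
    qed
  qed
  have "f \<in> H" if f: "relevant f" for f
  proof (rule ccontr)
    assume "f \<notin> H"
    then have "- f \<notin> H" using additive_subgroup_minus[OF H, of "- f"] by auto
    have "relevant (- f)"
      unfolding relevant_def
    proof safe
      show "- f \<in> L" using f L_minus by (simp add: relevant_def)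
      show False if "- f = 0" using that f by (simp add: relevant_def)
      show "0 < q g + B g (- f)" if "g \<in> L" "g \<noteq> 0" "g \<noteq> - (- f)" for g
      proof -
        have "- g \<in> L" "- g \<noteq> 0" "- g \<noteq> - f" using that L_minus by auto
        then have "0 < q (- g) + B (- g) f" using f unfolding relevant_def by blast
        then show ?thesis by (simp add: form_simps)
      qed
    qed
    with tie[OF f] tie[OF this] \<open>f \<notin> H\<close> \<open>- f \<notin> H\<close>
    have "q (p - f - y) = q (p - y)" "q (p + f - y) = q (p - y)" by auto
    \<comment> \<open>By the parallelogram law the two squared distances add up to
      \<open>2 * q (p - y) + 2 * q f\<close>.\<close>
    then have "q f = 0" by (simp add: form_simps sym)
    then show False using f q_eq_0_iff by (auto simp: relevant_def)
  qed
  then show "a \<in> H" using relevant_generate[OF H] \<open>a \<in> L\<close> by blast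
qed

end

section \<open>Generating choices of nearest points\<close>

lemma generates_mono: "generates S L \<Longrightarrow> S \<subseteq> T \<Longrightarrow> generates T L"
  unfolding generates_def by (meson subsetD)

lemma of_int_le_square: "real_of_int k \<le> (real_of_int k)\<^sup>2" "- real_of_int k \<le> (real_of_int k)\<^sup>2"
proof -
  have "0 \<le> k * (k - 1)" "0 \<le> k * (k + 1)"
    by (auto simp: zero_le_mult_iff)
  then have "k \<le> k\<^sup>2" "- k \<le> k\<^sup>2"
    by (simp_all add: power2_eq_square algebra_simps)
  then show "real_of_int k \<le> (real_of_int k)\<^sup>2" "- real_of_int k \<le> (real_of_int k)\<^sup>2"
    by (metis of_int_le_iff of_int_power, metis of_int_le_iff of_int_power of_int_minus)
qed

text \<open>For an integer \<open>k\<close> and a weight \<open>w \<ge> 0\<close>, the absolute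
  value of \<open>w * k\<close> is at most \<open>w * k^2\<close>, and each left side involves two
  of the three terms of \<open>N\<close>. The left sides will be pairings of a lattice vector with
  the edges of a triangle.\<close>

lemma selling_bounds:
  fixes a b c :: real and i j :: int
  assumes "0 \<le> a" "0 \<le> b" "0 \<le> c"
  defines "N \<equiv> a * (of_int i)\<^sup>2 + b * (of_int (i + j))\<^sup>2 + c * (of_int j)\<^sup>2"
  shows "\<bar>a * of_int i + b * of_int (i + j)\<bar> \<le> N"
    and "\<bar>b * of_int (i + j) + c * of_int j\<bar> \<le> N"
    and "\<bar>c * of_int j - a * of_int i\<bar> \<le> N"
proof -
  have *: "\<bar>w * real_of_int k\<bar> \<le> w * (real_of_int k)\<^sup>2" if "0 \<le> w" for w k
    using that of_int_le_square[of k] by (auto simp: abs_mult abs_le_iff intro!: mult_left_mono)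
  show "\<bar>a * of_int i + b * of_int (i + j)\<bar> \<le> N"
    and "\<bar>b * of_int (i + j) + c * of_int j\<bar> \<le> N"
    and "\<bar>c * of_int j - a * of_int i\<bar> \<le> N"
    unfolding N_def using *[OF assms(1), of i] *[OF assms(2), of "i + j"] *[OF assms(3), of j]
    by (smt (verit))+
qed

context lattice_pair
begin

text \<open>Encodes a function on the quotient of \<open>L\<close> by \<open>L'\<close> as a
  function on \<open>L\<close>, so that it can be evaluated at any representative.\<close>

definition nearest_selection :: "'v \<Rightarrow> ('v \<Rightarrow> 'v) \<Rightarrow> bool" where
  "nearest_selection y \<sigma> \<longleftrightarrow>
     (\<forall>a\<in>L. \<sigma> a \<in> nearest y \<and> \<sigma> a - a \<in> L') \<and> (\<forall>a\<in>L. \<forall>b\<in>L. a - b \<in> L' \<longrightarrow> \<sigma> a = \<sigma> b)"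

lemma nearest_selection_extends:
  assumes S: "S \<subseteq> nearest y" and inj: "\<And>s s'. s \<in> S \<Longrightarrow> s' \<in> S \<Longrightarrow> s - s' \<in> L' \<Longrightarrow> s = s'"
  obtains \<sigma> where "nearest_selection y \<sigma>" "S \<subseteq> \<sigma> ` L"
proof -
  \<comment> \<open>\<open>P a\<close> gives priority to points of \<open>S\<close> and depends only
    on the class of \<open>a\<close>, so the choice by \<open>SOME\<close> is constant on
    classes.\<close>
  define P where "P a p \<longleftrightarrow> p \<in> nearest y \<and> p - a \<in> L' \<and> ((\<exists>s\<in>S. s - a \<in> L') \<longrightarrow> p \<in> S)" for a p
  define \<sigma> where "\<sigma> a = (SOME p. P a p)" for a
  have P: "P a (\<sigma> a)" if "a \<in> L" for a
  proof -
    have "\<exists>p. P a p"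
      using nearest_in_class[OF that, of y] S unfolding P_def by (metis subsetD)
    then show ?thesis unfolding \<sigma>_def by (rule someI_ex)
  qed
  have shift: "p - a \<in> L' \<longleftrightarrow> p - b \<in> L'" if "a - b \<in> L'" for p a b
    using L'_add[OF _ that, of "p - a"] L'_diff[OF _ that, of "p - b"] by auto
  have cong: "\<sigma> a = \<sigma> b" if "a - b \<in> L'" for a b
    unfolding \<sigma>_def P_def using shift[OF that] by simp
  have "nearest_selection y \<sigma>"
    unfolding nearest_selection_def using P cong by (auto simp: P_def)
  moreover have "S \<subseteq> \<sigma> ` L"
  proof
    fix s assume s: "s \<in> S"
    then have sL: "s \<in> L" using S by (auto simp: nearest_def)
    have "s - s \<in> L'" using L'_zero by simp
    then have "\<sigma> s \<in> S" "\<sigma> s - s \<in> L'" using P[OF sL] s unfolding P_def by blast+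
    then have "\<sigma> s = s" using inj s by blast
    then show "s \<in> \<sigma> ` L" using sL by force
  qed
  ultimately show ?thesis by (rule that)
qed

lemma generating_selection_ge_3:
  assumes L': "\<And>m. m \<in> L' \<Longrightarrow> \<exists>g\<in>L. m = d *\<^sub>R g" and d: "d \<ge> 3"
  obtains \<sigma> where "nearest_selection y \<sigma>" "generates (\<sigma> ` L) L"
proof -
  obtain \<sigma> where \<sigma>: "nearest_selection y \<sigma>"
    using nearest_selection_extends[of "{}" y] by auto
  have "generates (\<sigma> ` L) L"
    by (rule nearest_generates[OF L' d]) (use \<sigma> in \<open>auto simp: nearest_selection_def\<close>)
  then show ?thesis using that \<sigma> by blast
qed

section \<open>Lattices generated by two vectors: reduced pairs and Delaunay triangles\<close>

definition generating_pair :: "'v \<Rightarrow> 'v \<Rightarrow> bool" where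
  "generating_pair u v \<longleftrightarrow>
     u \<in> L \<and> v \<in> L \<and> (\<forall>a\<in>L. \<exists>i j::int. a = of_int i *\<^sub>R u + of_int j *\<^sub>R v)"

lemma generating_pair_minus:
  assumes "generating_pair u v"
  shows "generating_pair u (- v)"
  unfolding generating_pair_def
proof safe
  show "u \<in> L" "- v \<in> L" using assms L_minus by (auto simp: generating_pair_def)
  fix a assume "a \<in> L"
  then obtain i j where "a = of_int i *\<^sub>R u + of_int j *\<^sub>R v"
    using assms by (auto simp: generating_pair_def)
  then have "a = of_int i *\<^sub>R u + of_int (- j) *\<^sub>R (- v)" by simp
  then show "\<exists>i j. a = of_int i *\<^sub>R u + of_int j *\<^sub>R - v" by blast
qed

lemma generating_pair_commute: "generating_pair u v \<Longrightarrow> generating_pair v u"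
  unfolding generating_pair_def by (metis add.commute)

lemma generating_pair_diff:
  assumes "generating_pair u v"
  shows "generating_pair u (v - u)"
  unfolding generating_pair_def
proof safe
  show "u \<in> L" "v - u \<in> L" using assms L_diff by (auto simp: generating_pair_def)
  fix a assume "a \<in> L"
  then obtain i j where "a = of_int i *\<^sub>R u + of_int j *\<^sub>R v"
    using assms by (auto simp: generating_pair_def)
  then have "a = of_int (i + j) *\<^sub>R u + of_int j *\<^sub>R (v - u)" by (simp add: algebra_simps)
  then show "\<exists>i j. a = of_int i *\<^sub>R u + of_int j *\<^sub>R (v - u)" by blast
qed

text \<open>Lagrange-Gauss reduction: a generating pair minimising \<open>q u + q v\<close> exists
  by finiteness, and replacing \<open>v\<close> by \<open>v - u\<close> or \<open>u\<close> by
  \<open>u - v\<close> cannot shorten it. A sign change of \<open>v\<close> makes the angle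
  nonobtuse.\<close>

lemma acute_generating_pair:
  assumes "generating_pair u0 v0"
  obtains u v where "generating_pair u v" "0 \<le> B u v" "2 * B u v \<le> q u" "2 * B u v \<le> q v"
proof -
  define K where "K = q u0 + q v0"
  let ?F = "{(u, v). generating_pair u v \<and> q u + q v \<le> K}"
  have "?F \<subseteq> {a \<in> L. q a \<le> K} \<times> {a \<in> L. q a \<le> K}"
  proof
    fix z assume "z \<in> ?F"
    then obtain u v where "z = (u, v)" "generating_pair u v" "q u + q v \<le> K" by blast
    then show "z \<in> {a \<in> L. q a \<le> K} \<times> {a \<in> L. q a \<le> K}"
      using q_nonneg[of u] q_nonneg[of v] by (simp add: generating_pair_def)
  qed
  then have "finite ?F"
    by (rule finite_subset) (intro finite_cartesian_product finite_L)
  moreover have "(u0, v0) \<in> ?F" using assms by (simp add: K_def)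
  ultimately have "finite ?F" "?F \<noteq> {}" by blast+
  then obtain z where z: "z \<in> ?F"
    and min: "\<And>w. w \<in> ?F \<Longrightarrow> q (fst z) + q (snd z) \<le> q (fst w) + q (snd w)"
    by (rule finite_has_minimizer[where f = "\<lambda>w. q (fst w) + q (snd w)"]) (rule that)
  define u where "u = fst z"
  define v where "v = (if B u (snd z) \<ge> 0 then snd z else - snd z)"
  have z': "generating_pair u (snd z)" "q u + q (snd z) \<le> K"
    using z by (auto simp: u_def)
  have K: "q (snd z) = q v" and pos: "0 \<le> B u v"
    by (simp_all add: v_def form_simps)
  have gp: "generating_pair u v"
    using z'(1) generating_pair_minus by (simp add: v_def)
  have min': "q u + q v \<le> q u' + q v'" if "generating_pair u' v'" for u' v'
  proof (cases "q u' + q v' \<le> K")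
    case True
    then show ?thesis using min[of "(u', v')"] that K by (simp add: u_def)
  qed (use K z'(2) in linarith)
  have "q u + q v \<le> q u + q (v - u)"
    by (intro min' generating_pair_diff gp)
  then have "2 * B u v \<le> q u" by (simp add: form_simps sym)
  moreover have "q u + q v \<le> q (u - v) + q v"
    by (rule min'[OF generating_pair_commute[OF generating_pair_diff[OF generating_pair_commute[OF gp]]]])
  then have "2 * B u v \<le> q v" by (simp add: form_simps sym)
  ultimately show ?thesis using that gp pos by blast
qed

text \<open>Selling's formula: \<open>q (i u + j v)\<close> is the combination of \<open>i\<^sup>2\<close>, \<open>(i + j)\<^sup>2\<close>, \<open>j\<^sup>2\<close> with the
  nonnegative weights \<open>q u - B u v\<close>, \<open>B u v\<close>, \<open>q v - B u v\<close>.\<close>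

lemma acute_pair_bounds:
  assumes gp: "generating_pair u v" and acute: "0 \<le> B u v" "2 * B u v \<le> q u" "2 * B u v \<le> q v"
    and g: "g \<in> L" and w: "w \<in> {u, v, v - u}"
  shows "\<bar>B w g\<bar> \<le> q g"
proof -
  obtain i j where ij: "g = of_int i *\<^sub>R u + of_int j *\<^sub>R v"
    using gp g by (auto simp: generating_pair_def)
  have nn: "0 \<le> q u - B u v" "0 \<le> B u v" "0 \<le> q v - B u v"
    using acute q_nonneg[of u] q_nonneg[of v] by linarith+
  have q: "q g = (q u - B u v) * (of_int i)\<^sup>2 + B u v * (of_int (i + j))\<^sup>2 + (q v - B u v) * (of_int j)\<^sup>2"
    and B: "B u g = (q u - B u v) * of_int i + B u v * of_int (i + j)"
      "B v g = B u v * of_int (i + j) + (q v - B u v) * of_int j"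
    unfolding ij using sym[of v u] by (simp_all add: form_simps power2_eq_square algebra_simps)
  have vu: "B (v - u) g = (q v - B u v) * of_int j - (q u - B u v) * of_int i"
    unfolding bilinear_lsub[OF bilinear] B by simp
  consider "w = u" | "w = v" | "w = v - u" using w by blast
  then show ?thesis
    unfolding q using selling_bounds[OF nn, where i = i and j = j] B vu by cases simp_all
qed

text \<open>The vertices of a Delaunay triangle containing \<open>y\<close> are nearest to \<open>y\<close> modulo \<open>2L\<close>.\<close>

lemma triangle_nearest:
  assumes L': "\<And>m. m \<in> L' \<Longrightarrow> \<exists>g\<in>L. m = d *\<^sub>R g" and d: "d \<ge> 2"
    and gp: "generating_pair u v"
    and bound: "\<And>g w. g \<in> L \<Longrightarrow> w \<in> {u, v, v - u} \<Longrightarrow> \<bar>B w g\<bar> \<le> q g"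
    and p: "p \<in> L" and y: "y = p + s *\<^sub>R u + t *\<^sub>R v" "0 \<le> s" "0 \<le> t" "s + t \<le> 1"
  shows "{p, p + u, p + v} \<subseteq> nearest y"
proof -
  \<comment> \<open>For \<open>m\<close> equal to \<open>d\<close> times \<open>g\<close>, the
    inequality to prove amounts to \<open>2 * B (y - p') g \<le> d * q g\<close>, so
    \<open>B (y - p') g \<le> q g\<close> suffices when \<open>d \<ge> 2\<close>.\<close>
  have near: "p' \<in> nearest y" if p': "p' \<in> L" and le: "\<And>g. g \<in> L \<Longrightarrow> B (y - p') g \<le> q g" for p'
    unfolding nearest_def
  proof safe
    fix m assume "m \<in> L'"
    then obtain g where g: "g \<in> L" "m = d *\<^sub>R g" using L' by blast
    have "2 * B (y - p') g \<le> d * q g"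
      using le[OF g(1)] mult_right_mono[OF d q_nonneg[of g]] by linarith
    then have "0 \<le> d * (d * q g - 2 * B (y - p') g)" using d by auto
    also have "\<dots> = q (p' + m - y) - q (p' - y)"
      unfolding g(2) by (simp add: form_simps sym) (simp add: algebra_simps)
    finally show "q (p' - y) \<le> q (p' + m - y)" by simp
  qed (fact p')
  have conv: "\<alpha> * a + \<beta> * b \<le> c" if "0 \<le> \<alpha>" "0 \<le> \<beta>" "\<alpha> + \<beta> \<le> 1" "\<bar>a\<bar> \<le> c" "\<bar>b\<bar> \<le> c" for \<alpha> \<beta> a b c :: real
  proof -
    have "\<alpha> * a + \<beta> * b \<le> \<alpha> * c + \<beta> * c"
      using that by (intro add_mono mult_left_mono) auto
    also have "\<dots> = (\<alpha> + \<beta>) * c" by (simp add: algebra_simps)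
    also have "\<dots> \<le> c" using that mult_right_mono[of "\<alpha> + \<beta>" 1 c] by auto
    finally show ?thesis .
  qed
  have uv: "u \<in> L" "v \<in> L" using gp by (auto simp: generating_pair_def)
  have "p \<in> nearest y"
  proof (rule near[OF p])
    fix g assume g: "g \<in> L"
    have "B (y - p) g = s * B u g + t * B v g" by (simp add: y form_simps)
    then show "B (y - p) g \<le> q g"
      using conv[OF y(2-4) bound[OF g, of u] bound[OF g, of v]] by simp
  qed
  moreover have "p + u \<in> nearest y"
  proof (rule near[OF L_add[OF p uv(1)]])
    fix g assume g: "g \<in> L"
    \<comment> \<open>From the vertex \<open>p + u\<close>, the point \<open>y\<close> is reached
      along the edges \<open>- u\<close> and \<open>v - u\<close> with nonnegative coefficients of
      sum at most 1.\<close>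
    have "B (y - (p + u)) g = (1 - s - t) * (- B u g) + t * B (v - u) g"
      by (simp add: y form_simps algebra_simps)
    then show "B (y - (p + u)) g \<le> q g"
      using conv[of "1 - s - t" t "- B u g" "q g" "B (v - u) g"] y bound[OF g, of u] bound[OF g, of "v - u"] by simp
  qed
  moreover have "p + v \<in> nearest y"
  proof (rule near[OF L_add[OF p uv(2)]])
    fix g assume g: "g \<in> L"
    have "B (y - (p + v)) g = (1 - s - t) * (- B v g) + s * (- B (v - u) g)"
      by (simp add: y form_simps algebra_simps)
    then show "B (y - (p + v)) g \<le> q g"
      using conv[of "1 - s - t" s "- B v g" "q g" "- B (v - u) g"] y bound[OF g, of v] bound[OF g, of "v - u"] by simp
  qed
  ultimately show ?thesis by blast
qed

text \<open>Parallelograms on a reduced pair, cut along a diagonal, give triangles covering the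
  span. Distinct vertices of the triangle around \<open>y\<close> are nearest points in distinct
  classes, so one selection contains them all, and their differences generate
  \<open>L\<close>.\<close>

lemma generating_selection_pair:
  assumes L': "\<And>m. m \<in> L' \<Longrightarrow> \<exists>g\<in>L. m = d *\<^sub>R g" and d: "d \<ge> 2"
    and "generating_pair u0 v0"
  obtains \<sigma> where "nearest_selection y \<sigma>" "generates (\<sigma> ` L) L"
proof -
  obtain u v where gp: "generating_pair u v" and acute: "0 \<le> B u v" "2 * B u v \<le> q u" "2 * B u v \<le> q v"
    using acute_generating_pair assms(3) by blast
  have bound: "\<bar>B w g\<bar> \<le> q g" if "g \<in> L" "w \<in> {u, v, v - u}" for g w
    by (rule acute_pair_bounds[OF gp acute that])
  have uv: "u \<in> L" "v \<in> L" using gp by (auto simp: generating_pair_def)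
  have "L \<subseteq> span {u, v}"
  proof
    fix a assume "a \<in> L"
    then obtain i j where "a = of_int i *\<^sub>R u + of_int j *\<^sub>R v"
      using gp by (auto simp: generating_pair_def)
    then show "a \<in> span {u, v}" by (simp add: span_add span_scale span_base)
  qed
  then have "y \<in> span {u, v}"
    using span_L span_mono span_span by (metis UNIV_I subsetD)
  then obtain s t where y: "y = s *\<^sub>R u + t *\<^sub>R v"
    by (auto simp: span_breakdown_eq algebra_simps)
  define p where "p = of_int \<lfloor>s\<rfloor> *\<^sub>R u + of_int \<lfloor>t\<rfloor> *\<^sub>R v"
  have pL: "p \<in> L"
    unfolding p_def using uv by (intro L_add additive_subgroup_of_int[OF subgroup_L])
  have yp: "y = p + frac s *\<^sub>R u + frac t *\<^sub>R v"
    by (simp add: y p_def frac_def algebra_simps)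
  obtain p u v where gp: "generating_pair u v"
    and bound: "\<And>g w. g \<in> L \<Longrightarrow> w \<in> {u, v, v - u} \<Longrightarrow> \<bar>B w g\<bar> \<le> q g"
    and near: "{p, p + u, p + v} \<subseteq> nearest y"
  proof (cases "frac s + frac t \<le> 1")
    case True
    then show ?thesis
      using that[OF gp bound] triangle_nearest[OF L' d gp bound pL yp] by simp
  next
    case False
    \<comment> \<open>The other half of the parallelogram is the triangle with corner
      \<open>p + u + v\<close> and edges \<open>- u\<close> and \<open>- v\<close>.\<close>
    have gp': "generating_pair (- u) (- v)"
      using gp generating_pair_minus generating_pair_commute by blast
    have bound': "\<bar>B w g\<bar> \<le> q g" if "g \<in> L" "w \<in> {- u, - v, - v - - u}" for g w
    proof -
      have "- w \<in> {u, v, v - u}" using that(2) by auto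
      from bound[OF that(1) this] show ?thesis by (simp add: form_simps)
    qed
    have yp': "y = (p + u + v) + (1 - frac s) *\<^sub>R (- u) + (1 - frac t) *\<^sub>R (- v)"
      unfolding yp by (simp add: algebra_simps)
    have "{p + u + v, p + u + v + - u, p + u + v + - v} \<subseteq> nearest y"
      using triangle_nearest[OF L' d gp' bound' _ yp'] False
        L_add[OF L_add[OF pL uv(1)] uv(2)] frac_lt_1[of s] frac_lt_1[of t] by simp
    then show ?thesis
      using that[OF gp' bound'] by blast
  qed
  \<comment> \<open>If \<open>w\<close> is \<open>d\<close> times \<open>g\<close>, the bound gives
    \<open>d * q g \<le> q g\<close>, impossible for \<open>g\<close> nonzero. Zero edges do occur,
    since a generator may vanish in rank one.\<close>
  have eq0: "w = 0" if "w \<in> {u, v, v - u}" "w \<in> L'" for w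
  proof -
    obtain g where g: "g \<in> L" "w = d *\<^sub>R g" using L' \<open>w \<in> L'\<close> by blast
    have "\<bar>d * q g\<bar> \<le> q g" using bound[OF g(1) that(1)] g(2) by (simp add: form_simps)
    then have "d * q g \<le> q g" by simp
    moreover have "2 * q g \<le> d * q g" by (rule mult_right_mono[OF d q_nonneg])
    ultimately have "q g = 0" using q_nonneg[of g] by linarith
    then show ?thesis using g q_eq_0_iff by simp
  qed
  let ?S = "{p, p + u, p + v}"
  have neg: "- w = 0" if "w \<in> {u, v, v - u}" "- w \<in> L'" for w
    using eq0[OF that(1)] L'_minus[OF that(2)] by simp
  have inj: "s = s'" if "s \<in> ?S" "s' \<in> ?S" "s - s' \<in> L'" for s s'
  proof -
    have "s - s' = 0 \<or> s - s' \<in> {u, v, v - u} \<or> - (s - s') \<in> {u, v, v - u}"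
      using that(1,2) by auto
    then have "s - s' = 0"
      using eq0[OF _ that(3)] neg[of "- (s - s')"] that(3) by (auto simp del: right_minus_eq)
    then show ?thesis by simp
  qed
  obtain \<sigma> where \<sigma>: "nearest_selection y \<sigma>" "?S \<subseteq> \<sigma> ` L"
    using nearest_selection_extends[OF near inj] by blast
  have "generates ?S L"
    unfolding generates_def
  proof safe
    fix H a assume H: "additive_subgroup H" and SH: "\<forall>p'\<in>?S. \<forall>p''\<in>?S. p' - p'' \<in> H" and "a \<in> L"
    obtain i j where a: "a = of_int i *\<^sub>R u + of_int j *\<^sub>R v"
      using gp \<open>a \<in> L\<close> by (auto simp: generating_pair_def)
    have "(p + u) - p \<in> H" "(p + v) - p \<in> H" using SH by blast+
    then have "u \<in> H" "v \<in> H" by simp_all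
    then show "a \<in> H"
      unfolding a by (intro additive_subgroup_add[OF H] additive_subgroup_of_int[OF H])
  qed
  then show ?thesis using that[OF \<sigma>(1)] generates_mono \<sigma>(2) by blast
qed

end

section \<open>The polyhedral decomposition and the theta functions of a sublattice\<close>

context lattice_pair
begin

text \<open>The affine function of \<open>x\<close> that \<open>p\<close> contributes to the minimum
  defining the theta function of its class.\<close>

definition height :: "'v \<Rightarrow> 'v \<Rightarrow> 'v \<Rightarrow> real" where
  "height r p x = B x p + 1/2 * q (p - r)"

lemma height_eq: "height r p x = 1/2 * q (p - (r - x)) + (B x r - 1/2 * q x)"
  unfolding height_def by (simp add: form_simps sym) (simp add: field_simps)

lemma height_affine:
  "height r p ((1 - t) *\<^sub>R x + t *\<^sub>R y) = (1 - t) * height r p x + t * height r p y"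
  unfolding height_def bilinear_ladd[OF bilinear] bilinear_lmul[OF bilinear]
  by (simp add: field_simps)

lemma height_le_iff: "height r p x \<le> height r p' x \<longleftrightarrow> q (p - (r - x)) \<le> q (p' - (r - x))"
  by (simp add: height_eq)

lemma nearest_height_le:
  "p \<in> nearest (r - x) \<Longrightarrow> p' - p \<in> L' \<Longrightarrow> height r p x \<le> height r p' x"
  using nearestD height_le_iff by blast

text \<open>Turns being nearest into a tie of two affine functions, once one nearest point
  \<open>s\<close> of the class is known. The face arguments rest on such ties.\<close>

lemma nearest_class_iff:
  assumes "s \<in> nearest (r - x)" "p \<in> L" "s - p \<in> L'"
  shows "p \<in> nearest (r - x) \<longleftrightarrow> height r p x = height r s x"
proof
  have ps: "p - s \<in> L'" using L'_minus[OF assms(3)] by simp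
  show "height r p x = height r s x" if "p \<in> nearest (r - x)"
    using nearest_height_le[OF that assms(3)] nearest_height_le[OF assms(1) ps] by simp
  show "p \<in> nearest (r - x)" if eq: "height r p x = height r s x"
    unfolding nearest_def
  proof safe
    fix m assume "m \<in> L'"
    then have "p + m - s \<in> L'" using L'_add[OF ps] by (metis add.commute add_diff_eq)
    from nearest_height_le[OF assms(1) this] eq
    have "height r p x \<le> height r (p + m) x" by simp
    then show "q (p - (r - x)) \<le> q (p + m - (r - x))" by (simp add: height_le_iff)
  qed (fact assms(2))
qed

lemma nearest_subset_L: "nearest y \<subseteq> L"
  by (auto simp: nearest_def)

section \<open>Cells of the decomposition and their faces\<close>

definition common_cell :: "'v \<Rightarrow> 'v set \<Rightarrow> 'v set" where
  "common_cell r S = {z. S \<subseteq> nearest (r - z)}"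

text \<open>At other points of the cell further lattice points may become nearest, but none of those
  at \<open>x\<close> is lost. So \<open>x\<close> is in its relative interior.\<close>

definition cell :: "'v \<Rightarrow> 'v \<Rightarrow> 'v set" where
  "cell r x = common_cell r (nearest (r - x))"

lemma in_cell_self: "x \<in> cell r x"
  by (simp add: cell_def common_cell_def)

text \<open>Being nearest to \<open>r - z\<close> means that \<open>p - (r - z)\<close> lies in the
  Voronoi cell of \<open>L'\<close>, cut out by finitely many vectors according to
  \<open>finite_voronoi\<close>. Hence one \<open>F\<close> serves all \<open>p\<close> and all
  \<open>S\<close>.\<close>

lemma common_cell_halfspaces:
  obtains F where "finite F" "F \<subseteq> L'"
    "\<And>S. S \<subseteq> L \<Longrightarrow> common_cell r S = {z. \<forall>p\<in>S. \<forall>m\<in>F. height r p z \<le> height r (p + m) z}"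
proof -
  obtain F where F: "finite F" "F \<subseteq> L'"
    and vor: "\<And>w m. (\<forall>m\<in>F. 0 \<le> q m + 2 * B m w) \<Longrightarrow> m \<in> L' \<Longrightarrow> 0 \<le> q m + 2 * B m w"
    using finite_voronoi by blast
  have diff: "2 * (height r (p + m) z - height r p z) = q m + 2 * B m (p - (r - z))" for p m z
    unfolding height_def by (simp add: form_simps sym) (simp add: field_simps)
  have expand: "height r p z \<le> height r (p + m) z \<longleftrightarrow> 0 \<le> q m + 2 * B m (p - (r - z))" for p m z
    unfolding diff[symmetric] by simp
  have "p \<in> nearest (r - z) \<longleftrightarrow> (\<forall>m\<in>F. height r p z \<le> height r (p + m) z)" if "p \<in> L" for p z
  proof -
    have "p \<in> nearest (r - z) \<longleftrightarrow> (\<forall>m\<in>L'. height r p z \<le> height r (p + m) z)"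
      using that by (simp add: nearest_def height_le_iff)
    then show ?thesis
      unfolding expand using vor F(2) by blast
  qed
  then have "common_cell r S = {z. \<forall>p\<in>S. \<forall>m\<in>F. height r p z \<le> height r (p + m) z}" if "S \<subseteq> L" for S
    using \<open>S \<subseteq> L\<close> unfolding common_cell_def subset_iff by (intro Collect_cong) meson
  then show thesis
    by (rule that[OF F])
qed

lemma cell_finite_halfspaces:
  "\<exists>H. finite H \<and> H \<subseteq> L' \<times> UNIV \<and> cell r x = {z. \<forall>(m, a)\<in>H. B z m \<ge> a}"
proof -
  obtain F where F: "finite F" "F \<subseteq> L'"
    and "\<And>S. S \<subseteq> L \<Longrightarrow> common_cell r S = {z. \<forall>p\<in>S. \<forall>m\<in>F. height r p z \<le> height r (p + m) z}"
    by (rule common_cell_halfspaces[of r]) (rule that)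
  then have cell: "cell r x = {z. \<forall>p\<in>nearest (r - x). \<forall>m\<in>F. height r p z \<le> height r (p + m) z}"
    unfolding cell_def using nearest_subset_L by simp
  define c where "c p m = (q (p - r) - q (p + m - r)) / 2" for p m
  have "height r (p + m) z - height r p z = B z m - c p m" for p m z
    unfolding height_def c_def bilinear_radd[OF bilinear] by (simp add: field_simps)
  then have halfspace: "height r p z \<le> height r (p + m) z \<longleftrightarrow> c p m \<le> B z m" for p m z
    by (metis diff_ge_0_iff_ge)
  let ?H = "(\<lambda>(p, m). (m, c p m)) ` (nearest (r - x) \<times> F)"
  have "cell r x = {z. \<forall>(m, a)\<in>?H. a \<le> B z m}"
    unfolding cell halfspace by auto
  then show ?thesis
    using F finite_nearest_point by (intro exI[of _ ?H]) auto
qed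

lemma convex_common_cell: "S \<subseteq> L \<Longrightarrow> convex (common_cell r S)"
proof -
  assume S: "S \<subseteq> L"
  obtain F where "\<And>S. S \<subseteq> L \<Longrightarrow> common_cell r S = {z. \<forall>p\<in>S. \<forall>m\<in>F. height r p z \<le> height r (p + m) z}"
    by (rule common_cell_halfspaces[of r]) (rule that)
  then have F: "common_cell r S = {z. \<forall>p\<in>S. \<forall>m\<in>F. height r p z \<le> height r (p + m) z}"
    using S by simp
  show ?thesis
    unfolding convex_alt F
  proof (clarify, unfold height_affine)
    fix x y p m and t :: real
    assume "\<forall>p\<in>S. \<forall>m\<in>F. height r p x \<le> height r (p + m) x"
      "\<forall>p\<in>S. \<forall>m\<in>F. height r p y \<le> height r (p + m) y" "0 \<le> t" "t \<le> 1" "p \<in> S" "m \<in> F"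
    then show "(1 - t) * height r p x + t * height r p y \<le> (1 - t) * height r (p + m) x + t * height r (p + m) y"
      by (intro add_mono mult_left_mono) simp_all
  qed
qed

text \<open>For \<open>p\<close> in \<open>T\<close> and \<open>s\<close> in \<open>S\<close> of the
  same class, the height of \<open>p\<close> minus that of \<open>s\<close> is affine and
  nonnegative on the cell of \<open>S\<close>; vanishing inside a segment, it vanishes at both
  ends.\<close>

lemma common_cell_face_of:
  assumes ST: "S \<subseteq> T" and T: "T \<subseteq> L" and classes: "\<And>p. p \<in> T \<Longrightarrow> \<exists>s\<in>S. s - p \<in> L'"
  shows "common_cell r T face_of common_cell r S"
  unfolding face_of_def
proof (intro conjI ballI impI)
  show "common_cell r T \<subseteq> common_cell r S"
    using ST by (auto simp: common_cell_def)
  show "convex (common_cell r T)"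
    using T by (rule convex_common_cell)
  fix a b z assume a: "a \<in> common_cell r S" and b: "b \<in> common_cell r S"
    and z: "z \<in> common_cell r T" and seg: "z \<in> open_segment a b"
  obtain t where t: "0 < t" "t < 1" "z = (1 - t) *\<^sub>R a + t *\<^sub>R b"
    using seg by (auto simp: in_segment)
  have "p \<in> nearest (r - a) \<and> p \<in> nearest (r - b)" if p: "p \<in> T" for p
  proof -
    obtain s where s: "s \<in> S" "s - p \<in> L'" using classes p by blast
    have pL: "p \<in> L" using p T by blast
    have ps: "p - s \<in> L'" using L'_minus[OF s(2)] by simp
    have sn: "s \<in> nearest (r - a)" "s \<in> nearest (r - b)"
      using a b s by (auto simp: common_cell_def)
    have "s \<in> nearest (r - z)" "p \<in> nearest (r - z)"
      using z s p ST by (auto simp: common_cell_def)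
    then have "height r p z = height r s z"
      using nearest_class_iff[OF _ pL s(2)] by blast
    then have "(1 - t) * (height r p a - height r s a) + t * (height r p b - height r s b) = 0"
      unfolding t(3) height_affine by (simp add: algebra_simps)
    moreover have "0 \<le> height r p a - height r s a" "0 \<le> height r p b - height r s b"
      using nearest_height_le sn ps by auto
    moreover have "0 \<le> 1 - t" "0 \<le> t" using t by simp_all
    ultimately have "(1 - t) * (height r p a - height r s a) = 0" "t * (height r p b - height r s b) = 0"
      by (metis add_nonneg_eq_0_iff mult_nonneg_nonneg)+
    then have "height r p a = height r s a" "height r p b = height r s b"
      using t by simp_all
    then show ?thesis
      using nearest_class_iff[OF _ pL s(2)] sn by auto
  qed
  then show "a \<in> common_cell r T" "b \<in> common_cell r T"
    by (auto simp: common_cell_def)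
qed

lemma cell_inter_face_of: "cell r x \<inter> cell r x' face_of cell r x"
proof -
  have "cell r x \<inter> cell r x' = common_cell r (nearest (r - x) \<union> nearest (r - x'))"
    by (auto simp: cell_def common_cell_def)
  moreover have "common_cell r (nearest (r - x) \<union> nearest (r - x')) face_of common_cell r (nearest (r - x))"
  proof (rule common_cell_face_of)
    show T: "nearest (r - x) \<union> nearest (r - x') \<subseteq> L"
      using nearest_subset_L by blast
    show "\<exists>s\<in>nearest (r - x). s - p \<in> L'" if "p \<in> nearest (r - x) \<union> nearest (r - x')" for p
      using nearest_in_class[of p] T that by blast
  qed blast
  ultimately show ?thesis by (simp add: cell_def)
qed

text \<open>An inequality strict at \<open>y\<close> survives a small step beyond \<open>y\<close>.
  One that is tight at \<open>y\<close> is tight at \<open>z\<close> too, because \<open>z\<close>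
  is in the cell of \<open>y\<close>, and hence along the whole line.\<close>

lemma extend_beyond:
  assumes y: "y \<in> cell r x" and z: "z \<in> cell r y"
  shows "\<exists>e>0. y + e *\<^sub>R (y - z) \<in> cell r x"
proof -
  let ?S = "nearest (r - x)"
  obtain F where F: "finite F" "F \<subseteq> L'"
    and "\<And>S. S \<subseteq> L \<Longrightarrow> common_cell r S = {z. \<forall>p\<in>S. \<forall>m\<in>F. height r p z \<le> height r (p + m) z}"
    by (rule common_cell_halfspaces[of r]) (rule that)
  then have cell: "common_cell r ?S = {z. \<forall>p\<in>?S. \<forall>m\<in>F. height r p z \<le> height r (p + m) z}"
    using nearest_subset_L by simp
  define g where "g p m w = height r (p + m) w - height r p w" for p m w
  have g_ext: "g p m (y + e *\<^sub>R (y - z)) = (1 + e) * g p m y - e * g p m z" for p m e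
    unfolding g_def height_def bilinear_ladd[OF bilinear] bilinear_lmul[OF bilinear]
      bilinear_lsub[OF bilinear] by (simp add: field_simps)
  have "\<forall>\<^sub>F e in at_right 0. \<forall>pm\<in>?S \<times> F. 0 \<le> (1 + e) * g (fst pm) (snd pm) y - e * g (fst pm) (snd pm) z"
  proof (rule eventually_ball_finite[OF finite_cartesian_product[OF finite_nearest_point F(1)]], safe)
    fix p m assume p: "p \<in> ?S" and m: "m \<in> F"
    have mL: "m \<in> L'" using m F by blast
    have py: "p \<in> nearest (r - y)" using p y by (auto simp: cell_def common_cell_def)
    have pz: "p \<in> nearest (r - z)" using py z by (auto simp: cell_def common_cell_def)
    have pmL: "p + m \<in> L" using p mL L'_subset nearest_subset_L L_add by blast
    have diff: "p - (p + m) \<in> L'" using L'_minus[OF mL] by simp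
    have "0 \<le> g p m y" using nearest_height_le[OF py, of "p + m"] mL by (simp add: g_def)
    then consider "g p m y = 0" | "g p m y > 0" by linarith
    then show "\<forall>\<^sub>F e in at_right 0. 0 \<le> (1 + e) * g (fst (p, m)) (snd (p, m)) y - e * g (fst (p, m)) (snd (p, m)) z"
    proof cases
      case 1
      then have "p + m \<in> nearest (r - y)"
        using nearest_class_iff[OF py pmL diff] by (simp add: g_def)
      then have "p + m \<in> nearest (r - z)" using z by (auto simp: cell_def common_cell_def)
      then have "g p m z = 0"
        using nearest_class_iff[OF pz pmL diff] by (simp add: g_def)
      then show ?thesis using 1 by simp
    next
      case 2
      have "((\<lambda>e. (1 + e) * g p m y - e * g p m z) \<longlongrightarrow> (1 + 0) * g p m y - 0 * g p m z) (at_right 0)"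
        by (intro tendsto_intros)
      then have "\<forall>\<^sub>F e in at_right 0. 0 < (1 + e) * g p m y - e * g p m z"
        using 2 by (intro order_tendstoD(1)) auto
      then show ?thesis by (auto elim: eventually_mono)
    qed
  qed
  then have "\<forall>\<^sub>F e in at_right 0. \<forall>p\<in>?S. \<forall>m\<in>F. 0 \<le> g p m (y + e *\<^sub>R (y - z))"
    unfolding g_ext by (rule eventually_mono) auto
  with eventually_at_right_less
  have "\<forall>\<^sub>F e in at_right 0. 0 < e \<and> (\<forall>p\<in>?S. \<forall>m\<in>F. 0 \<le> g p m (y + e *\<^sub>R (y - z)))"
    by (rule eventually_conj)
  then obtain e where "0 < e" "\<forall>p\<in>?S. \<forall>m\<in>F. 0 \<le> g p m (y + e *\<^sub>R (y - z))"
    using eventually_happens'[OF trivial_limit_at_right_real] by blast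
  then show ?thesis
    unfolding cell_def cell by (auto simp: g_def)
qed

text \<open>A face is the cell of any of its relatively interior points \<open>y\<close>.\<close>

lemma face_of_cell:
  assumes face: "F face_of cell r x" and "F \<noteq> {}"
  shows "F \<in> range (cell r)"
proof -
  let ?S = "nearest (r - x)"
  have convF: "convex F" using face by (rule face_of_imp_convex)
  then obtain y where y: "y \<in> rel_interior F"
    using rel_interior_eq_empty \<open>F \<noteq> {}\<close> by blast
  then have yF: "y \<in> F" using rel_interior_subset by blast
  have FS: "F \<subseteq> cell r x" using face by (rule face_of_imp_subset)
  \<comment> \<open>The segment from \<open>z\<close> to \<open>y\<close> can be prolonged inside
    \<open>F\<close>, so an affine function that is nonnegative on \<open>F\<close> and vanishes at
    \<open>y\<close> vanishes at \<open>z\<close>.\<close>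
  have "F \<subseteq> cell r y"
  proof
    fix z assume z: "z \<in> F"
    obtain e where e: "e > 1" "(1 - e) *\<^sub>R z + e *\<^sub>R y \<in> F"
      using convex_rel_interior_if[OF convF y] z hull_subset[of F affine] by blast
    have "p \<in> nearest (r - z)" if p: "p \<in> nearest (r - y)" for p
    proof -
      have pL: "p \<in> L" using p nearest_subset_L by blast
      obtain s where s: "s \<in> ?S" "s - p \<in> L'" using nearest_in_class[OF pL] by blast
      have ps: "p - s \<in> L'" using L'_minus[OF s(2)] by simp
      have sn: "s \<in> nearest (r - w)" if "w \<in> F" for w
        using that FS s by (auto simp: cell_def common_cell_def)
      have "height r p y = height r s y"
        using p nearest_class_iff[OF sn[OF yF] pL s(2)] by blast
      moreover have "height r s z \<le> height r p z"
        using nearest_height_le[OF sn[OF z] ps] .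
      moreover have "height r s ((1 - e) *\<^sub>R z + e *\<^sub>R y) \<le> height r p ((1 - e) *\<^sub>R z + e *\<^sub>R y)"
        using nearest_height_le[OF sn[OF e(2)] ps] .
      ultimately have "(1 - e) * (height r p z - height r s z) \<ge> 0" "height r p z - height r s z \<ge> 0"
        unfolding height_affine by (simp_all add: algebra_simps)
      then have "height r p z = height r s z"
        using e(1) by (simp add: zero_le_mult_iff)
      then show ?thesis
        using nearest_class_iff[OF sn[OF z] pL s(2)] by blast
    qed
    then show "z \<in> cell r y" by (auto simp: cell_def common_cell_def)
  qed
  \<comment> \<open>\<open>extend_beyond\<close> places \<open>y\<close> strictly between
    \<open>z\<close> and another point of \<open>cell r x\<close>; the face property then puts
    \<open>z\<close> into \<open>F\<close>.\<close>
  moreover have "cell r y \<subseteq> F"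
  proof
    fix z assume z: "z \<in> cell r y"
    have yx: "y \<in> cell r x" using yF FS by blast
    obtain e where e: "e > 0" "y + e *\<^sub>R (y - z) \<in> cell r x"
      using extend_beyond[OF yx z] by blast
    have zx: "z \<in> cell r x"
      using yx z by (auto simp: cell_def common_cell_def)
    show "z \<in> F"
    proof (cases "z = y")
      case False
      define t where "t = 1 / (1 + e)"
      have t: "t * e = 1 - t" "0 < t" "t < 1"
        using e(1) by (simp_all add: t_def field_simps)
      have "y = (1 - t) *\<^sub>R z + t *\<^sub>R (y + e *\<^sub>R (y - z))"
        by (simp only: scaleR_add_right scaleR_scaleR t(1)) (simp add: algebra_simps)
      moreover have "z \<noteq> y + e *\<^sub>R (y - z)"
      proof
        assume "z = y + e *\<^sub>R (y - z)"
        then have "(1 + e) *\<^sub>R (y - z) = 0" by (simp add: algebra_simps)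
        then show False using False e(1) by simp
      qed
      ultimately have "y \<in> open_segment z (y + e *\<^sub>R (y - z))"
        unfolding in_segment using t by (intro conjI exI[of _ t])
      then show ?thesis
        using face_ofD[OF face _ zx e(2) yF] by blast
    qed (use yF in simp)
  qed
  ultimately show ?thesis by blast
qed

text \<open>A cell meeting a small neighbourhood of \<open>x\<close> is determined by a set of
  nearest points inside the finite set \<open>F\<close> from \<open>finite_nearest\<close>.\<close>

lemma locally_finite_cells: "locally_finite_in euclidean (range (cell r))"
  unfolding locally_finite_in_def
proof (intro conjI ballI)
  fix x :: 'v
  let ?V = "{z. q (z - x) < 1}"
  have "open ?V"
    by (intro open_Collect_less bounded_bilinear.continuous_on[OF bounded_bilinear_form] continuous_intros)
  moreover have "x \<in> ?V" by (simp add: form_simps)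
  moreover have "finite {U \<in> range (cell r). U \<inter> ?V \<noteq> {}}"
  proof -
    obtain F where F: "finite F" "\<And>z. q (z - (r - x)) \<le> 1 \<Longrightarrow> nearest z \<subseteq> F"
      using finite_nearest[of "r - x" 1] by blast
    have "cell r y \<in> common_cell r ` Pow F" if meets: "cell r y \<inter> ?V \<noteq> {}" for y
    proof -
      obtain z where z: "z \<in> cell r y" "q (z - x) < 1" using meets by blast
      have "q ((r - z) - (r - x)) \<le> 1"
        using z(2) q_minus_commute[of x z] by simp
      then have "nearest (r - z) \<subseteq> F" by (rule F(2))
      then have "nearest (r - y) \<subseteq> F" using z(1) by (auto simp: cell_def common_cell_def)
      then show ?thesis by (auto simp: cell_def)
    qed
    then have "{U \<in> range (cell r). U \<inter> ?V \<noteq> {}} \<subseteq> common_cell r ` Pow F" by blast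
    then show ?thesis by (rule finite_subset) (use F(1) in simp)
  qed
  ultimately show "\<exists>V. openin euclidean V \<and> x \<in> V \<and> finite {U \<in> range (cell r). U \<inter> V \<noteq> {}}"
    by (intro exI[of _ ?V]) simp
qed simp

section \<open>Theta functions of the classes of \<open>L\<close> modulo \<open>L'\<close>\<close>

definition class_theta :: "'v \<Rightarrow> 'v \<Rightarrow> 'v \<Rightarrow> real" where
  "class_theta r c x = (LEAST t. t \<in> (\<lambda>u. B x (c + u) + 1/2 * q (u + c - r)) ` L')"

lemma class_theta_eq:
  assumes p: "p \<in> nearest (r - x)" "p - c \<in> L'"
  shows "class_theta r c x = height r p x"
  unfolding class_theta_def
proof (rule Least_equality)
  have "height r p x = B x (c + (p - c)) + 1/2 * q ((p - c) + c - r)"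
    by (simp add: height_def)
  then show "height r p x \<in> (\<lambda>u. B x (c + u) + 1/2 * q (u + c - r)) ` L'"
    using p(2) by blast
  fix t assume "t \<in> (\<lambda>u. B x (c + u) + 1/2 * q (u + c - r)) ` L'"
  then obtain u where u: "u \<in> L'" "t = height r (c + u) x"
    unfolding height_def add.commute[of c] by blast
  have "c + u - p \<in> L'" using L'_diff[OF u(1) p(2)] by (simp add: algebra_simps)
  then show "height r p x \<le> t" using nearest_height_le[OF p(1)] u(2) by simp
qed

lemma class_theta_le:
  assumes "c \<in> L" "p - c \<in> L'"
  shows "class_theta r c x \<le> height r p x"
proof -
  obtain p' where p': "p' \<in> nearest (r - x)" "p' - c \<in> L'"
    using nearest_in_class[OF assms(1)] by blast
  have "p - p' \<in> L'" using L'_diff[OF assms(2) p'(2)] by simp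
  then show ?thesis
    using class_theta_eq[OF p'] nearest_height_le[OF p'(1)] by simp
qed

text \<open>Quasi-periodicity: moving \<open>x\<close> by \<open>m\<close> moves the nearest points
  by \<open>- m\<close>, and the correction does not depend on \<open>c\<close>.\<close>

lemma class_theta_translate:
  assumes c: "c \<in> L" and m: "m \<in> L'"
  shows "class_theta r c (x + m) = class_theta r c x - B x m - 1/2 * q m + B m r"
proof -
  obtain p where p: "p \<in> nearest (r - x)" "p - c \<in> L'"
    using nearest_in_class[OF c] by blast
  have mL: "m \<in> L" using m L'_subset by blast
  have "q (p - m + k - (r - (x + m))) = q (p + k - (r - x))" for k
    by (rule arg_cong2[of _ _ _ _ B]) simp_all
  from this this[of 0] have "p - m \<in> nearest (r - (x + m))"
    using p(1) L_diff[OF _ mL, of p] unfolding nearest_def by simp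
  moreover have "p - m - c \<in> L'" using L'_diff[OF p(2) m] by (simp add: algebra_simps)
  ultimately have "class_theta r c (x + m) = height r (p - m) (x + m)"
    by (rule class_theta_eq)
  also have "\<dots> = height r p x - B x m - 1/2 * q m + B m r"
    unfolding height_def by (simp add: form_simps sym) (simp add: field_simps)
  finally show ?thesis using class_theta_eq[OF p] by simp
qed

lemma class_theta_cong:
  assumes "c \<in> L" "c - c' \<in> L'"
  shows "class_theta r c x = class_theta r c' x"
proof -
  obtain p where p: "p \<in> nearest (r - x)" "p - c \<in> L'"
    using nearest_in_class[OF assms(1)] by blast
  have "p - c' \<in> L'" using L'_add[OF p(2) assms(2)] by simp
  then show ?thesis using class_theta_eq p by simp
qed

text \<open>A minimum of affine functions is concave, and a finite concave function on the whole
  space is continuous.\<close>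

lemma continuous_class_theta:
  assumes c: "c \<in> L"
  shows "continuous_on UNIV (class_theta r c)"
proof -
  have "convex_on UNIV (\<lambda>x. - class_theta r c x)"
  proof (rule convex_onI)
    fix t :: real and x y :: 'v assume t: "0 < t" "t < 1"
    let ?z = "(1 - t) *\<^sub>R x + t *\<^sub>R y"
    obtain p where p: "p \<in> nearest (r - ?z)" "p - c \<in> L'"
      using nearest_in_class[OF c] by blast
    have "(1 - t) * class_theta r c x + t * class_theta r c y \<le> (1 - t) * height r p x + t * height r p y"
      using t class_theta_le[OF c p(2)] by (intro add_mono mult_left_mono) auto
    also have "\<dots> = class_theta r c ?z"
      using class_theta_eq[OF p] by (simp add: height_affine)
    finally show "- class_theta r c ?z \<le> (1 - t) * - class_theta r c x + t * - class_theta r c y"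
      by simp
  qed simp
  then have "continuous_on UNIV (\<lambda>x. - class_theta r c x)"
    by (intro convex_on_continuous) simp_all
  from continuous_on_minus[OF this] show ?thesis by simp
qed

lemma class_theta_separates:
  assumes L': "\<And>m. m \<in> L' \<Longrightarrow> \<exists>g\<in>L. m = d *\<^sub>R g" and d: "d \<ge> 3"
    and eq: "\<And>c. c \<in> L \<Longrightarrow> class_theta r c x - class_theta r c x' = C"
  shows "x - x' \<in> L'"
proof -
  have "(r - x') - (r - x) \<in> L'"
  proof (rule nearest_separates[OF L' d])
    fix p p' assume p: "p \<in> nearest (r - x')" "p' \<in> nearest (r - x)" "p - p' \<in> L'"
    have "class_theta r p x' = height r p x'"
      using p L'_zero by (intro class_theta_eq) auto
    moreover have "class_theta r p x = height r p' x"
      using p L'_minus[OF p(3)] by (intro class_theta_eq) auto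
    ultimately have "height r p' x - height r p x' = C"
      using eq[of p] p(1) nearest_subset_L by auto
    \<comment> \<open>The new constant absorbs the summands of \<open>height_eq\<close> that depend
      only on \<open>x\<close> and \<open>x'\<close>.\<close>
    then show "q (p - (r - x')) - q (p' - (r - x)) = 2 * ((B x r - 1/2 * q x) - (B x' r - 1/2 * q x') - C)"
      by (simp add: height_eq)
  qed auto
  then show ?thesis by simp
qed

end

section \<open>Lattice bases\<close>

locale real_lattice =
  fixes n :: nat and e :: "nat \<Rightarrow> 'a::real_vector" and L :: "'a set"
  assumes basis: "lattice_basis n e L"
begin

definition coord :: "nat \<Rightarrow> 'a \<Rightarrow> real" where
  "coord i x = representation (e ` {1..n}) x (e i)"

lemma inj: "inj_on e {1..n}"
  and indep: "independent (e ` {1..n})"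
  and span: "span (e ` {1..n}) = UNIV"
  and lattice: "L = {\<Sum>i=1..n. of_int (c i) *\<^sub>R e i | c :: nat \<Rightarrow> int. True}"
  using basis by (auto simp: lattice_basis_def)

lemma linear_coord: "linear (coord i)"
  by (rule linearI) (simp_all add: coord_def span indep representation_add representation_scale del: One_nat_def)

lemma coord_basis:
  assumes "i \<in> {1..n}" "j \<in> {1..n}"
  shows "coord i (e j) = (if i = j then 1 else 0)"
  unfolding coord_def representation_basis[OF indep imageI[OF assms(2)]]
  by (simp only: inj_on_eq_iff[OF inj assms])

lemma sum_coord: "(\<Sum>i=1..n. coord i x *\<^sub>R e i) = x"
proof -
  have "(\<Sum>b\<in>e ` {1..n}. representation (e ` {1..n}) x b *\<^sub>R b) = x"
    by (rule sum_representation_eq[OF indep]) (simp_all add: span del: One_nat_def)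
  then show ?thesis
    by (simp add: sum.reindex[OF inj] coord_def o_def del: One_nat_def)
qed

lemma coord_sum:
  assumes "i \<in> {1..n}"
  shows "coord i (\<Sum>j=1..n. c j *\<^sub>R e j) = c i"
proof -
  have "coord i (\<Sum>j=1..n. c j *\<^sub>R e j) = (\<Sum>j=1..n. c j * coord i (e j))"
    using linear_coord[of i] by (simp add: linear_sum linear_scale)
  also have "\<dots> = (\<Sum>j=1..n. if i = j then c j else 0)"
    using assms by (intro sum.cong) (simp_all add: coord_basis)
  also have "\<dots> = c i" using assms by simp
  finally show ?thesis .
qed

lemma lattice_memI: "(\<Sum>i=1..n. of_int (c i) *\<^sub>R e i) \<in> L"
  unfolding lattice by blast

lemma lattice_memE:
  assumes "x \<in> L"
  obtains c :: "nat \<Rightarrow> int" where "x = (\<Sum>i=1..n. of_int (c i) *\<^sub>R e i)"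
  using assms unfolding lattice by blast

lemma subgroup_lattice: "additive_subgroup L"
  unfolding additive_subgroup_def
proof (intro conjI ballI)
  show "0 \<in> L" using lattice_memI[of "\<lambda>_. 0"] by simp
  fix a b assume "a \<in> L" "b \<in> L"
  obtain c where "a = (\<Sum>i=1..n. of_int (c i) *\<^sub>R e i)"
    using \<open>a \<in> L\<close> by (rule lattice_memE)
  moreover obtain c' where "b = (\<Sum>i=1..n. of_int (c' i) *\<^sub>R e i)"
    using \<open>b \<in> L\<close> by (rule lattice_memE)
  ultimately have "a - b = (\<Sum>i=1..n. of_int (c i - c' i) *\<^sub>R e i)"
    by (simp add: sum_subtractf scaleR_diff_left)
  then show "a - b \<in> L" by (simp only: lattice_memI)
qed

lemma basis_in_lattice:
  assumes "i \<in> {1..n}"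
  shows "e i \<in> L"
proof -
  have "(\<Sum>j=1..n. of_int (if i = j then 1 else 0) *\<^sub>R e j) = (\<Sum>j=1..n. if i = j then e j else 0)"
    by (intro sum.cong) auto
  also have "\<dots> = e i" using assms by simp
  finally show ?thesis using lattice_memI[of "\<lambda>j. if i = j then 1 else 0"] by simp
qed

lemma span_lattice: "span L = UNIV"
proof -
  have "span (e ` {1..n}) \<subseteq> span L"
    by (intro span_mono) (use basis_in_lattice in blast)
  then show ?thesis using span by blast
qed

end

text \<open>Bounded coordinates leave finitely many integer coefficient vectors. Boundedness is
  asked of linear images because the type carries no norm.\<close>

lemma (in real_lattice) finite_lattice_inter:
  assumes "\<And>f :: 'a \<Rightarrow> real. linear f \<Longrightarrow> bounded (f ` S)"
  shows "finite (L \<inter> S)"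
proof -
  have "\<exists>K::int. \<forall>x\<in>S. \<bar>coord i x\<bar> \<le> of_int K" for i
  proof -
    have "bounded (coord i ` S)" using assms linear_coord by blast
    then obtain K where "\<forall>x\<in>S. \<bar>coord i x\<bar> \<le> K" by (auto simp: bounded_iff)
    then show ?thesis by (intro exI[of _ "\<lceil>K\<rceil>"]) (auto intro: order_trans[OF _ le_of_int_ceiling])
  qed
  then have "\<exists>K. \<forall>i. \<forall>x\<in>S. \<bar>coord i x\<bar> \<le> of_int (K i :: int)"
    by (intro choice allI)
  then obtain K where K: "\<And>i x. x \<in> S \<Longrightarrow> \<bar>coord i x\<bar> \<le> of_int (K i)" by blast
  have "L \<inter> S \<subseteq> (\<lambda>c. \<Sum>i=1..n. of_int (c i) *\<^sub>R e i) ` (PiE {1..n} (\<lambda>i. {- K i..K i}))"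
  proof
    fix x assume x: "x \<in> L \<inter> S"
    then have "x \<in> L" by blast
    then obtain c where c: "x = (\<Sum>i=1..n. of_int (c i) *\<^sub>R e i)"
      by (rule lattice_memE)
    have "c i \<in> {- K i..K i}" if "i \<in> {1..n}" for i
    proof -
      have "\<bar>real_of_int (c i)\<bar> \<le> of_int (K i)"
        using K[of x i] x coord_sum[OF that, of "\<lambda>j. of_int (c j)"] c by simp
      then have "\<bar>c i\<bar> \<le> K i" by (simp only: of_int_abs[symmetric] of_int_le_iff)
      then show ?thesis by auto
    qed
    moreover have "x = (\<Sum>i=1..n. of_int (restrict c {1..n} i) *\<^sub>R e i)"
      unfolding c by (intro sum.cong) simp_all
    ultimately show "x \<in> (\<lambda>c. \<Sum>i=1..n. of_int (c i) *\<^sub>R e i) ` (PiE {1..n} (\<lambda>i. {- K i..K i}))"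
      by (intro image_eqI[of _ _ "restrict c {1..n}"]) auto
  qed
  then show ?thesis
    by (rule finite_subset) (intro finite_imageI finite_PiE; simp)
qed

lemma lattice_basis_finite:
  fixes L :: "'a::euclidean_space set"
  assumes "lattice_basis n e L" "bounded S"
  shows "finite (L \<inter> S)"
proof -
  interpret real_lattice n e L using assms(1) by unfold_locales
  have "bounded (f ` S)" if "linear f" for f :: "'a \<Rightarrow> real"
    using bounded_linear_image[OF assms(2)] that by (simp add: linear_conv_bounded_linear)
  then show ?thesis by (rule finite_lattice_inter)
qed

lemma lattice_basis_cobounded:
  fixes L :: "'a::real_normed_vector set"
  assumes "lattice_basis n e L"
  shows "\<exists>K. \<forall>x. \<exists>m\<in>L. norm (x - m) \<le> K"
proof (intro exI allI)
  interpret real_lattice n e L using assms(1) by unfold_locales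
  fix x
  define m where "m = (\<Sum>i=1..n. of_int \<lfloor>coord i x\<rfloor> *\<^sub>R e i)"
  have "x - m = (\<Sum>i=1..n. coord i x *\<^sub>R e i) - m"
    by (simp only: sum_coord)
  also have "\<dots> = (\<Sum>i=1..n. frac (coord i x) *\<^sub>R e i)"
    by (simp add: m_def frac_def sum_subtractf scaleR_diff_left)
  also have "norm \<dots> \<le> (\<Sum>i=1..n. norm (e i))"
    by (rule sum_norm_le) (simp add: frac_ge_0 frac_lt_1 less_imp_le mult_left_le_one_le)
  finally have "norm (x - m) \<le> (\<Sum>i=1..n. norm (e i))" .
  moreover have "m \<in> L" unfolding m_def by (rule lattice_memI)
  ultimately show "\<exists>m\<in>L. norm (x - m) \<le> (\<Sum>i=1..n. norm (e i))" by blast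
qed

section \<open>Tropical abelian varieties\<close>

locale polarized_torus =
  fixes M :: "('v::euclidean_space \<Rightarrow>\<^sub>L real) set" and M' :: "'v set"
    and Q :: "'v \<Rightarrow>\<^sub>L 'v \<Rightarrow>\<^sub>L real" and d :: "nat \<Rightarrow> nat"
    and w :: "nat \<Rightarrow> 'v" and e :: "nat \<Rightarrow> 'v \<Rightarrow>\<^sub>L real"
  assumes polarization: "polarization M M' Q"
    and d_pos: "i \<in> {1..DIM('v)} \<Longrightarrow> d i > 0"
    and d_dvd: "i \<in> {1..<DIM('v)} \<Longrightarrow> d i dvd d (Suc i)"
    and basis_M': "lattice_basis DIM('v) w M'"
    and basis_M: "lattice_basis DIM('v) e M"
    and Q_basis: "i \<in> {1..DIM('v)} \<Longrightarrow> blinfun_apply Q (w i) = real (d i) *\<^sub>R e i"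
begin

sublocale lat': real_lattice "DIM('v)" w M'
  using basis_M' by unfold_locales

sublocale lat: real_lattice "DIM('v)" e M
  using basis_M by unfold_locales

text \<open>Since \<open>Q\<close> sends \<open>w i\<close> to \<open>d i\<close> times
  \<open>e i\<close>, these are the preimages of the basis \<open>e\<close>, hence a basis of the
  lattice \<open>L\<close>.\<close>

definition f :: "nat \<Rightarrow> 'v" where "f i = (1 / real (d i)) *\<^sub>R w i"

definition L :: "'v set" where "L = blinfun_apply Q -` M"

sublocale form: posdef_form "\<lambda>x y. blinfun_apply (blinfun_apply Q x) y"
proof
  show "bilinear (\<lambda>x y. blinfun_apply (blinfun_apply Q x) y)"
    unfolding bilinear_def by (auto intro!: linearI simp: blinfun.bilinear_simps)
qed (use polarization in \<open>auto simp: polarization_def\<close>)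

lemma Q_inj: "inj (blinfun_apply Q)"
proof (rule injI)
  fix x y assume "blinfun_apply Q x = blinfun_apply Q y"
  then have "blinfun_apply (blinfun_apply Q (x - y)) (x - y) = 0"
    by (simp add: blinfun.bilinear_simps)
  then show "x = y" using form.q_eq_0_iff by simp
qed

lemma Q_f: "i \<in> {1..DIM('v)} \<Longrightarrow> blinfun_apply Q (f i) = e i"
  using Q_basis[of i] d_pos[of i] by (simp add: f_def blinfun.scaleR_right)

lemma Q_sum: "blinfun_apply Q (\<Sum>i=1..DIM('v). c i *\<^sub>R f i) = (\<Sum>i=1..DIM('v). c i *\<^sub>R e i)"
  by (simp add: blinfun.sum_right blinfun.scaleR_right Q_f)

lemma L_memI: "(\<Sum>i=1..DIM('v). of_int (c i) *\<^sub>R f i) \<in> L"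
  unfolding L_def vimage_eq Q_sum by (rule lat.lattice_memI)

lemma L_memE:
  assumes "a \<in> L"
  obtains c :: "nat \<Rightarrow> int" where "a = (\<Sum>i=1..DIM('v). of_int (c i) *\<^sub>R f i)"
proof -
  have "blinfun_apply Q a \<in> M" using assms by (simp add: L_def)
  then obtain c where "blinfun_apply Q a = (\<Sum>i=1..DIM('v). of_int (c i) *\<^sub>R e i)"
    by (rule lat.lattice_memE)
  also have "\<dots> = blinfun_apply Q (\<Sum>i=1..DIM('v). of_int (c i) *\<^sub>R f i)"
    by (rule Q_sum[symmetric])
  finally show thesis
    using Q_inj that by (meson injD)
qed

lemma scaled_mem_L:
  assumes "\<And>i. i \<in> {1..DIM('v)} \<Longrightarrow> real (d i) * k i = real N"
    and "m = (\<Sum>i=1..DIM('v). c i *\<^sub>R f i)"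
  shows "real N *\<^sub>R m = (\<Sum>i=1..DIM('v). (c i * k i) *\<^sub>R w i)"
  unfolding assms(2) scaleR_sum_right
proof (rule sum.cong)
  fix i assume i: "i \<in> {1..DIM('v)}"
  have "real N * c i * (1 / real (d i)) = c i * k i"
    using assms(1)[OF i, symmetric] d_pos[OF i] by simp
  then show "real N *\<^sub>R c i *\<^sub>R f i = (c i * k i) *\<^sub>R w i"
    by (simp add: f_def)
qed simp

text \<open>Each \<open>f i\<close> times \<open>d i\<close> is \<open>w i\<close>, and every
  \<open>d i\<close> divides the product. Finiteness of the set of short vectors of \<open>L\<close>
  is thereby reduced to \<open>M'\<close>.\<close>

lemma multiple_in_M':
  assumes "a \<in> L"
  shows "real (\<Prod>i=1..DIM('v). d i) *\<^sub>R a \<in> M'"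
proof -
  define k where "k i = (\<Prod>j\<in>{1..DIM('v)} - {i}. d j)" for i
  have k: "real (d i) * real (k i) = real (\<Prod>i=1..DIM('v). d i)" if "i \<in> {1..DIM('v)}" for i
  proof -
    have "(\<Prod>i=1..DIM('v). d i) = d i * k i"
      unfolding k_def using that by (intro prod.remove) auto
    then show ?thesis by (simp only: of_nat_mult)
  qed
  obtain c where "a = (\<Sum>i=1..DIM('v). of_int (c i) *\<^sub>R f i)"
    using assms by (rule L_memE)
  from scaled_mem_L[OF k this]
  have "real (\<Prod>i=1..DIM('v). d i) *\<^sub>R a = (\<Sum>i=1..DIM('v). of_int (c i * int (k i)) *\<^sub>R w i)"
    by simp
  then show ?thesis by (simp only: lat'.lattice_memI)
qed

lemma d_1_dvd: "i \<in> {1..DIM('v)} \<Longrightarrow> d 1 dvd d i"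
proof (induction i)
  case (Suc i)
  show ?case
  proof (cases "i = 0")
    case False
    then have "d 1 dvd d i" "d i dvd d (Suc i)" using Suc d_dvd[of i] by auto
    then show ?thesis by (rule dvd_trans)
  qed simp
qed simp

text \<open>As \<open>w i\<close> is \<open>d i\<close> times \<open>f i\<close> and
  \<open>d 1\<close> divides \<open>d i\<close>, division by \<open>d 1\<close> stays in
  \<open>L\<close>. This is the hypothesis of the nearest point lemmas.\<close>

lemma M'_multiple:
  assumes "m \<in> M'"
  shows "\<exists>g\<in>L. m = real (d 1) *\<^sub>R g"
proof -
  obtain c where c: "m = (\<Sum>i=1..DIM('v). of_int (c i) *\<^sub>R w i)"
    using assms by (rule lat'.lattice_memE)
  let ?g = "\<Sum>i=1..DIM('v). of_int (c i * int (d i div d 1)) *\<^sub>R f i"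
  have "m = real (d 1) *\<^sub>R ?g"
    unfolding c scaleR_sum_right
  proof (rule sum.cong)
    fix i assume i: "i \<in> {1..DIM('v)}"
    have "real (d 1) * real (d i div d 1) = real (d i)"
      using d_1_dvd[OF i] by (simp flip: of_nat_mult)
    then have "real (d 1) * (of_int (c i * int (d i div d 1)) * (1 / real (d i))) = of_int (c i)"
      using d_pos[OF i] by (simp add: field_simps)
    then show "of_int (c i) *\<^sub>R w i = real (d 1) *\<^sub>R of_int (c i * int (d i div d 1)) *\<^sub>R f i"
      unfolding f_def scaleR_scaleR by simp
  qed simp
  then show ?thesis by (rule bexI[OF _ L_memI])
qed

lemma M'_subset_L: "M' \<subseteq> L"
proof
  fix m assume "m \<in> M'"
  then obtain g where g: "g \<in> L" "m = real (d 1) *\<^sub>R g" using M'_multiple by blast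
  have "blinfun_apply Q m = of_nat (d 1) *\<^sub>R blinfun_apply Q g"
    by (simp add: g(2) blinfun.scaleR_right)
  then show "m \<in> L"
    using additive_subgroup_of_nat[OF lat.subgroup_lattice, of "blinfun_apply Q g" "d 1"] g(1)
    by (simp add: L_def)
qed

sublocale lattice_pair "\<lambda>x y. blinfun_apply (blinfun_apply Q x) y" L M'
proof
  show "additive_subgroup L"
    using lat.subgroup_lattice by (auto simp: additive_subgroup_def L_def blinfun.bilinear_simps)
  show "additive_subgroup M'" by (rule lat'.subgroup_lattice)
  show "M' \<subseteq> L" by (rule M'_subset_L)
  show "span L = UNIV"
    using span_mono[OF M'_subset_L] lat'.span_lattice by blast
  show "finite {a \<in> L. blinfun_apply (blinfun_apply Q a) a \<le> R}" for R
  proof -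
    let ?N = "real (\<Prod>i=1..DIM('v). d i)"
    have N: "?N \<noteq> 0" using d_pos by fastforce
    have "finite (M' \<inter> {x. blinfun_apply (blinfun_apply Q x) x \<le> ?N\<^sup>2 * R})"
      by (rule lattice_basis_finite[OF basis_M' form.bounded_q_le])
    moreover have "(*\<^sub>R) ?N ` {a \<in> L. blinfun_apply (blinfun_apply Q a) a \<le> R} \<subseteq>
        M' \<inter> {x. blinfun_apply (blinfun_apply Q x) x \<le> ?N\<^sup>2 * R}"
      by (auto simp: form.q_scaleR intro!: mult_left_mono multiple_in_M' simp del: of_nat_prod One_nat_def)
    ultimately have "finite ((*\<^sub>R) ?N ` {a \<in> L. blinfun_apply (blinfun_apply Q a) a \<le> R})"
      by (rule finite_subset[rotated])
    moreover have "inj_on ((*\<^sub>R) ?N) {a \<in> L. blinfun_apply (blinfun_apply Q a) a \<le> R}"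
      using N by (intro inj_onI) (simp only: scaleR_cancel_left simp_thms)
    ultimately show ?thesis by (rule finite_imageD)
  qed
  show "\<exists>R. \<forall>x. \<exists>m\<in>M'. blinfun_apply (blinfun_apply Q (x - m)) (x - m) \<le> R"
  proof -
    obtain K where K: "\<And>x. \<exists>m\<in>M'. norm (x - m) \<le> K"
      using lattice_basis_cobounded[OF basis_M'] by blast
    have "blinfun_apply (blinfun_apply Q z) z \<le> norm Q * K * K" if "norm z \<le> K" for z
    proof -
      have "blinfun_apply (blinfun_apply Q z) z \<le> norm (blinfun_apply Q z) * norm z"
        using norm_blinfun[of "blinfun_apply Q z" z] by simp
      also have "\<dots> \<le> norm Q * norm z * norm z"
        by (intro mult_right_mono norm_blinfun norm_ge_zero)
      also have "\<dots> \<le> norm Q * K * K"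
        using that order_trans[OF norm_ge_zero that] by (intro mult_mono mult_nonneg_nonneg) simp_all
      finally show ?thesis .
    qed
    then show ?thesis using K by meson
  qed
qed

lemma ex_generating_pair:
  assumes "DIM('v) \<le> 2"
  shows "\<exists>u v. generating_pair u v"
proof (cases "DIM('v) = 1")
  case True
  have "f 1 \<in> L" using Q_f[of 1] lat.basis_in_lattice[of 1] by (simp add: L_def Suc_leI)
  moreover have "\<exists>i j::int. a = of_int i *\<^sub>R f 1 + of_int j *\<^sub>R 0" if a: "a \<in> L" for a
  proof -
    obtain c where "a = (\<Sum>i=1..DIM('v). of_int (c i) *\<^sub>R f i)" using a by (rule L_memE)
    then show ?thesis unfolding True by auto
  qed
  \<comment> \<open>In rank one the second generator is zero; a generating pair need not be
    independent.\<close>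
  ultimately have "generating_pair (f 1) 0" using L_zero by (simp add: generating_pair_def)
  then show ?thesis by blast
next
  case False
  then have 2: "DIM('v) = Suc 1" using assms DIM_positive[where 'a='v] by linarith
  have "f 1 \<in> L" "f 2 \<in> L"
    using Q_f[of 1] lat.basis_in_lattice[of 1] Q_f[of 2] lat.basis_in_lattice[of 2] 2 by (simp_all add: L_def)
  moreover have "\<exists>i j::int. a = of_int i *\<^sub>R f 1 + of_int j *\<^sub>R f 2" if a: "a \<in> L" for a
  proof -
    obtain c where "a = (\<Sum>i=1..DIM('v). of_int (c i) *\<^sub>R f i)" using a by (rule L_memE)
    then have "a = of_int (c 1) *\<^sub>R f 1 + of_int (c 2) *\<^sub>R f 2"
      unfolding 2 by (simp add: numeral_2_eq_2)
    then show ?thesis by blast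
  qed
  ultimately have "generating_pair (f 1) (f 2)" by (simp add: generating_pair_def)
  then show ?thesis by blast
qed

lemma ex_generating_selection:
  assumes "d 1 \<ge> 2 * fact (DIM('v) - 1)"
  shows "\<exists>\<sigma>. nearest_selection y \<sigma> \<and> generates (\<sigma> ` L) L"
proof (cases "DIM('v) \<le> 2")
  case True
  then obtain u v where "generating_pair u v" using ex_generating_pair by blast
  moreover have "2 * 1 \<le> d 1"
    by (rule order_trans[OF _ assms]) (intro mult_left_mono fact_ge_1; simp)
  then have "real (d 1) \<ge> 2" by simp
  ultimately show ?thesis
    using generating_selection_pair[OF M'_multiple] by metis
next
  case False
  have "fact 2 \<le> (fact (DIM('v) - 1) :: nat)"
    using False by (intro fact_mono_nat) linarith
  then have "real (d 1) \<ge> 3" using assms by (simp add: fact_2)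
  then show ?thesis
    using generating_selection_ge_3[OF M'_multiple] by metis
qed

end

section \<open>Topology of the torus and of the target space\<close>

lemma continuous_map_into_Euclidean_space:
  assumes "\<And>i. i < m \<Longrightarrow> continuous_on UNIV (\<lambda>x. f x i)" "\<And>x i. i \<ge> m \<Longrightarrow> f x i = 0"
  shows "continuous_map euclidean (Euclidean_space m) f"
  unfolding Euclidean_space_def continuous_map_in_subtopology
proof
  show "continuous_map euclidean (powertop_real UNIV) f"
    unfolding continuous_map_componentwise_UNIV
  proof
    fix i
    show "continuous_map euclidean euclideanreal (\<lambda>x. f x i)"
      using assms by (cases "i < m") (simp_all add: not_less)
  qed
  show "f \<in> topspace euclidean \<rightarrow> {x. \<forall>i\<ge>m. x i = 0}"
    using assms(2) by auto
qed

lemma Hausdorff_Euclidean_space: "Hausdorff_space (Euclidean_space m)"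
  unfolding Euclidean_space_def
  by (intro Hausdorff_space_subtopology) (simp add: Hausdorff_space_product_topology)

context
  fixes M' :: "'v::euclidean_space set"
  assumes subgroup: "additive_subgroup M'"
begin

lemma coset_eqI:
  assumes "x - x' \<in> M'"
  shows "coset M' x = coset M' x'"
proof -
  have "coset M' y \<subseteq> coset M' y'" if "y - y' \<in> M'" for y y'
  proof
    fix z assume "z \<in> coset M' y"
    then obtain u where u: "u \<in> M'" "z = y + u" by (auto simp: coset_def)
    have "z = y' + ((y - y') + u)" using u by simp
    then show "z \<in> coset M' y'"
      unfolding coset_def using additive_subgroup_add[OF subgroup that u(1)] by blast
  qed
  then show ?thesis
    using assms additive_subgroup_minus[OF subgroup assms] by (simp add: subset_antisym)
qed

lemma some_in_coset: "(SOME y. y \<in> coset M' x) - x \<in> M'"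
proof -
  have "x + 0 \<in> coset M' x"
    unfolding coset_def using additive_subgroup_zero[OF subgroup] by (rule imageI)
  then have "(SOME y. y \<in> coset M' x) \<in> coset M' x" by (rule someI)
  then show ?thesis by (auto simp: coset_def)
qed

lemma compact_torus:
  assumes "\<And>x. \<exists>m\<in>M'. norm (x - m) \<le> K"
  shows "compact_space (torus M')"
proof -
  have "topspace (torus M') = coset M' ` cball 0 K"
  proof -
    have "coset M' x \<in> coset M' ` cball 0 K" for x
    proof -
      obtain m where m: "m \<in> M'" "norm (x - m) \<le> K" using assms by blast
      then have "coset M' x = coset M' (x - m)" by (intro coset_eqI) simp
      then show ?thesis using m(2) by simp
    qed
    then show ?thesis by (auto simp: topspace_torus)
  qed
  moreover have "compactin (torus M') (coset M' ` cball 0 K)"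
    by (rule image_compactin[OF _ quotient_imp_continuous_map[OF quotient_map_coset]]) simp
  ultimately show ?thesis by (simp add: compact_space_def)
qed

end

section \<open>The theta map of a system of representatives\<close>

locale polarized_torus_reps = polarized_torus +
  fixes l :: "'a \<Rightarrow> real" and D :: nat and b :: "nat \<Rightarrow> 'a \<Rightarrow>\<^sub>L real"
  assumes D_pos: "D > 0"
    and reps: "complete_reps M (blinfun_apply Q ` M') D b"
begin

text \<open>The facts about \<open>class_theta r\<close> hold for arbitrary \<open>r\<close>, so this description is never unfolded.\<close>

definition r :: 'a where "r = (THE r. \<forall>u\<in>M'. l u = blinfun_apply (blinfun_apply Q u) r)"

definition c :: "nat \<Rightarrow> 'a" where "c i = inv (blinfun_apply Q) (b i)"

lemma theta_eq: "theta M' Q l (b i) x = class_theta r (c i) x"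
  by (simp add: theta_def class_theta_def Let_def r_def c_def)

lemma ex_preimage:
  assumes "u \<in> M"
  shows "\<exists>a\<in>L. blinfun_apply Q a = u"
proof -
  obtain k where "u = (\<Sum>i=1..DIM('a). of_int (k i) *\<^sub>R e i)"
    using assms by (rule lat.lattice_memE)
  then have "blinfun_apply Q (\<Sum>i=1..DIM('a). of_int (k i) *\<^sub>R f i) = u"
    by (simp only: Q_sum)
  then show ?thesis by (rule bexI[OF _ L_memI])
qed

lemma Q_c: "i < D \<Longrightarrow> blinfun_apply Q (c i) = b i"
  unfolding c_def using ex_preimage[of "b i"] reps
  by (intro f_inv_into_f) (metis complete_reps_def rangeI)

lemma c_in_L: "i < D \<Longrightarrow> c i \<in> L"
  using reps by (simp add: L_def Q_c complete_reps_def)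

lemma class_representative:
  assumes "a \<in> L"
  obtains i where "i < D" "a - c i \<in> M'"
proof -
  have "blinfun_apply Q a \<in> M" using assms by (simp add: L_def)
  then obtain i where i: "i < D" "blinfun_apply Q a - b i \<in> blinfun_apply Q ` M'"
    using reps unfolding complete_reps_def by blast
  then obtain m where m: "m \<in> M'" "blinfun_apply Q a - b i = blinfun_apply Q m" by blast
  have "blinfun_apply Q (a - c i) = blinfun_apply Q m"
    using m(2) by (simp add: blinfun.diff_right Q_c i(1))
  then have "a - c i = m" using Q_inj by (simp add: inj_eq)
  then show thesis using that i(1) m(1) by blast
qed

text \<open>The lift chosen by \<open>SOME\<close> differs from \<open>x\<close> by an element of
  \<open>M'\<close>, and the quasi-periodicity correction is the same for all classes, so it
  cancels.\<close>

lemma theta_map_coset: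
  "theta_map M' Q l D b (coset M' x) =
     (\<lambda>i. if i < D - 1 then class_theta r (c i) x - class_theta r (c (D - 1)) x else 0)"
proof
  fix i
  define x' where "x' = (SOME y. y \<in> coset M' x)"
  have m: "x' - x \<in> M'"
    unfolding x'_def by (rule some_in_coset[OF subgroup_L'])
  have shift: "class_theta r (c i) x' = class_theta r (c i) x
      - blinfun_apply (blinfun_apply Q x) (x' - x)
      - 1/2 * blinfun_apply (blinfun_apply Q (x' - x)) (x' - x)
      + blinfun_apply (blinfun_apply Q (x' - x)) r" if "i < D" for i
    using class_theta_translate[OF c_in_L[OF that] m, of r x] by simp
  show "theta_map M' Q l D b (coset M' x) i =
      (if i < D - 1 then class_theta r (c i) x - class_theta r (c (D - 1)) x else 0)"
    using shift[of i] shift[of "D - 1"] D_pos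
    unfolding theta_map_def x'_def[symmetric] Let_def theta_eq by simp
qed

lemma continuous_theta_map:
  "continuous_map (torus M') (Euclidean_space (D - 1)) (theta_map M' Q l D b)"
proof (rule continuous_compose_quotient_map[OF quotient_map_coset])
  show "continuous_map euclidean (Euclidean_space (D - 1)) (theta_map M' Q l D b \<circ> coset M')"
  proof (rule continuous_map_into_Euclidean_space)
    show "continuous_on UNIV (\<lambda>x. (theta_map M' Q l D b \<circ> coset M') x i)" if "i < D - 1" for i
      using that D_pos
      by (simp add: theta_map_coset continuous_class_theta c_in_L continuous_on_diff)
  qed (simp add: theta_map_coset)
qed

text \<open>Compactness of the torus leaves injectivity to prove. Equal images mean that all theta
  functions differ by the same \<open>?C\<close> between the two lifts, as
  \<open>class_theta_separates\<close> requires.\<close>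

lemma embedding_theta_map:
  assumes "d 1 \<ge> 3"
  shows "embedding_map (torus M') (Euclidean_space (D - 1)) (theta_map M' Q l D b)"
proof (rule continuous_imp_embedding_map[OF continuous_theta_map _ Hausdorff_Euclidean_space])
  obtain K where "\<And>x. \<exists>m\<in>M'. norm (x - m) \<le> K"
    using lattice_basis_cobounded[OF basis_M'] by blast
  then show "compact_space (torus M')" by (rule compact_torus[OF subgroup_L'])
  show "inj_on (theta_map M' Q l D b) (topspace (torus M'))"
  proof (rule inj_onI)
    fix p p' assume "p \<in> topspace (torus M')" "p' \<in> topspace (torus M')"
      and eq: "theta_map M' Q l D b p = theta_map M' Q l D b p'"
    then obtain x x' where x: "p = coset M' x" "p' = coset M' x'"
      by (auto simp: topspace_torus)
    let ?C = "class_theta r (c (D - 1)) x - class_theta r (c (D - 1)) x'"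
    have reps_eq: "class_theta r (c i) x - class_theta r (c i) x' = ?C" if "i < D" for i
    proof (cases "i = D - 1")
      case False
      then have "i < D - 1" using that by linarith
      then show ?thesis
        using fun_cong[OF eq[unfolded x theta_map_coset], of i] by simp
    qed simp
    have "x - x' \<in> M'"
    proof (rule class_theta_separates[OF M'_multiple])
      show "class_theta r a x - class_theta r a x' = ?C" if a: "a \<in> L" for a
      proof -
        obtain i where i: "i < D" "a - c i \<in> M'" using a by (rule class_representative)
        show ?thesis using reps_eq[OF i(1)] class_theta_cong[OF a i(2)] by simp
      qed
    qed (use assms in auto)
    then show "p = p'" unfolding x by (rule coset_eqI[OF subgroup_L'])
  qed
qed

lemma polyhedral_decomposition_cells: "polyhedral_decomposition M (range (cell r))"
  unfolding polyhedral_decomposition_def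
proof (intro conjI ballI allI impI)
  fix P assume "P \<in> range (cell r)"
  then obtain x where P: "P = cell r x" by blast
  show "P \<noteq> {}" using in_cell_self P by blast
  obtain H where H: "finite H" "H \<subseteq> M' \<times> UNIV"
    "cell r x = {z. \<forall>(m, a)\<in>H. a \<le> blinfun_apply (blinfun_apply Q z) m}"
    using cell_finite_halfspaces[of r x] by (elim exE conjE) (rule that)
  \<comment> \<open>By symmetry, pairing \<open>z\<close> with \<open>m\<close> under
    \<open>Q\<close> is evaluating \<open>blinfun_apply Q m\<close>, an element of \<open>M\<close>,
    at \<open>z\<close>; so the inequalities are rational.\<close>
  let ?H = "(\<lambda>(m, a). (blinfun_apply Q m, a)) ` H"
  have "finite ?H" using H(1) by simp
  moreover have "?H \<subseteq> M \<times> UNIV"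
    using H(2) M'_subset_L by (auto simp: L_def)
  moreover have "P = {z. \<forall>(u, a)\<in>?H. blinfun_apply u z \<ge> a}"
    unfolding P H(3) by (auto simp: form.sym)
  ultimately show "rational_polyhedron M P"
    unfolding rational_polyhedron_def by blast
next
  show "\<Union> (range (cell r)) = UNIV" using in_cell_self by blast
next
  fix P F assume "P \<in> range (cell r)" "F face_of P \<and> F \<noteq> {}"
  then show "F \<in> range (cell r)" using face_of_cell by blast
next
  fix P P' assume "P \<in> range (cell r)" "P' \<in> range (cell r)"
  then show "P \<inter> P' face_of P" "P \<inter> P' face_of P'"
    using cell_inter_face_of by (auto simp: Int_commute)
next
  show "locally_finite_in euclidean (range (cell r))" by (rule locally_finite_cells)
qed

text \<open>As differences of selected points generate \<open>L\<close>, \<open>?A v\<close> is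
  integral exactly for \<open>v\<close> in the dual lattice. This gives integrality and a
  torsion-free cokernel: if \<open>k\<close> times an integral \<open>y\<close> is the image of
  \<open>v\<close>, then \<open>y\<close> is the image of \<open>v\<close> divided by
  \<open>k\<close>.\<close>

lemma unimodular_selection:
  assumes \<sigma>: "\<And>a. a \<in> L \<Longrightarrow> \<sigma> a \<in> L" and cong: "\<And>a a'. a \<in> L \<Longrightarrow> a' \<in> L \<Longrightarrow> a - a' \<in> M' \<Longrightarrow> \<sigma> a = \<sigma> a'"
    and gen: "generates (\<sigma> ` L) L"
  shows "unimodular_linear M (D - 1)
    (\<lambda>v i. if i < D - 1 then blinfun_apply (blinfun_apply Q v) (\<sigma> (c i) - \<sigma> (c (D - 1))) else 0)"
    (is "unimodular_linear M (D - 1) ?A")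
proof -
  \<comment> \<open>The formula includes \<open>i = D - 1\<close>, where both sides vanish, so all
    classes are treated alike.\<close>
  have diff: "blinfun_apply (blinfun_apply Q v) (\<sigma> (c i)) - blinfun_apply (blinfun_apply Q v) (\<sigma> (c (D - 1))) = ?A v i"
    if "i < D" for v i
  proof (cases "i < D - 1")
    case False
    then have "i = D - 1" using that by linarith
    then show ?thesis by simp
  qed (simp add: blinfun.diff_right)
  have dual_iff: "v \<in> dual_lattice M \<longleftrightarrow> (\<forall>i. ?A v i \<in> \<int>)" for v
  proof
    assume v: "v \<in> dual_lattice M"
    have "blinfun_apply (blinfun_apply Q v) a \<in> \<int>" if "a \<in> L" for a
      using v that unfolding dual_lattice_def L_def by (auto simp: form.sym[of v])
    then show "\<forall>i. ?A v i \<in> \<int>"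
      using \<sigma> c_in_L L_diff by simp
  next
    assume A: "\<forall>i. ?A v i \<in> \<int>"
    let ?H = "{a. blinfun_apply (blinfun_apply Q v) a \<in> \<int>}"
    have "additive_subgroup ?H"
      by (auto simp: additive_subgroup_def blinfun.diff_right)
    moreover have "p - p' \<in> ?H" if "p \<in> \<sigma> ` L" "p' \<in> \<sigma> ` L" for p p'
    proof -
      obtain a a' where a: "a \<in> L" "p = \<sigma> a" "a' \<in> L" "p' = \<sigma> a'" using \<open>p \<in> \<sigma> ` L\<close> \<open>p' \<in> \<sigma> ` L\<close> by blast
      obtain i where i: "i < D" "a - c i \<in> M'" using a(1) by (rule class_representative)
      obtain j where j: "j < D" "a' - c j \<in> M'" using a(3) by (rule class_representative)
      have "p = \<sigma> (c i)" "p' = \<sigma> (c j)"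
        using a cong[OF a(1) c_in_L[OF i(1)] i(2)] cong[OF a(3) c_in_L[OF j(1)] j(2)] by simp_all
      then have "blinfun_apply (blinfun_apply Q v) (p - p') = ?A v i - ?A v j"
        using diff[OF i(1), of v] diff[OF j(1), of v] by (simp only: blinfun.diff_right)
      then show ?thesis using A by (simp only: mem_Collect_eq Ints_diff)
    qed
    ultimately have "L \<subseteq> ?H" using gen unfolding generates_def by blast
    then show "v \<in> dual_lattice M"
      using ex_preimage unfolding dual_lattice_def by (auto simp: form.sym[of v])
  qed
  have linear: "linear (\<lambda>v. ?A v i)" for i
    by (intro linearI) (simp_all add: blinfun.bilinear_simps right_diff_distrib)
  have scale: "?A (t *\<^sub>R v) i = t * ?A v i" for t v i
    by (simp add: blinfun.bilinear_simps right_diff_distrib)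
  have inj: "inj ?A"
  proof (rule injI)
    fix v v' assume eq: "?A v = ?A v'"
    have zero: "?A (v - v') i = 0" for i
      using fun_cong[OF eq, of i] by (simp add: blinfun.bilinear_simps split: if_splits)
    \<comment> \<open>All real multiples of a vector killed by \<open>?A\<close> lie in the dual
      lattice; a nonzero pairing with some \<open>a\<close> could be scaled to 1/2.\<close>
    have int: "t *\<^sub>R (v - v') \<in> dual_lattice M" for t :: real
      unfolding dual_iff scale zero by simp
    have "blinfun_apply (blinfun_apply Q a) (v - v') = 0" if a: "a \<in> L" for a
    proof (rule ccontr)
      let ?s = "blinfun_apply (blinfun_apply Q a) (v - v')"
      assume "?s \<noteq> 0"
      have "blinfun_apply (blinfun_apply Q a) ((1 / (2 * ?s)) *\<^sub>R (v - v')) \<in> \<int>"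
        using int a unfolding dual_lattice_def L_def by blast
      then have "(1/2 :: real) \<in> \<int>"
        using \<open>?s \<noteq> 0\<close> by (simp add: blinfun.scaleR_right)
      then obtain k :: int where "1/2 = real_of_int k" by (rule Ints_cases)
      then have "real_of_int (2 * k) = 1" by simp
      then have "2 * k = 1" by (simp only: of_int_eq_1_iff)
      then show False by presburger
    qed
    moreover have "subspace {a. blinfun_apply (blinfun_apply Q a) (v - v') = 0}"
      by (auto simp: subspace_def blinfun.bilinear_simps)
    ultimately have "v - v' \<in> {a. blinfun_apply (blinfun_apply Q a) (v - v') = 0}"
      using span_L span_minimal[of L "{a. blinfun_apply (blinfun_apply Q a) (v - v') = 0}"] by blast
    then show "v = v'" using form.q_eq_0_iff[of "v - v'"] by simp
  qed
  show ?thesis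
    unfolding unimodular_linear_def
  proof (intro conjI allI ballI impI)
    show "?A ` dual_lattice M \<subseteq> integer_points (D - 1)"
      using dual_iff by (auto simp: integer_points_def topspace_Euclidean_space)
    show "inj_on ?A (dual_lattice M)" using inj by (rule inj_on_subset) simp
    fix y k assume y: "y \<in> integer_points (D - 1)"
      and k: "k \<noteq> 0 \<and> (\<lambda>i. real_of_int k * y i) \<in> ?A ` dual_lattice M"
    then obtain v where v: "(\<lambda>i. real_of_int k * y i) = ?A v" by blast
    have Ay: "?A ((1 / real_of_int k) *\<^sub>R v) i = y i" for i
      unfolding scale fun_cong[OF v, of i, symmetric] using k by simp
    then have "?A ((1 / real_of_int k) *\<^sub>R v) = y" by blast
    moreover have "(1 / real_of_int k) *\<^sub>R v \<in> dual_lattice M"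
      unfolding dual_iff Ay using y by (simp add: integer_points_def)
    ultimately show "y \<in> ?A ` dual_lattice M" by blast
  qed (rule linear)
qed

lemma unimodular_theta_map:
  assumes "d 1 \<ge> 2 * fact (DIM('a) - 1)"
  shows "unimodular M M' (D - 1) (theta_map M' Q l D b)"
  unfolding unimodular_def
proof (intro exI[of _ "range (cell r)"] conjI ballI)
  show "polyhedral_decomposition M (range (cell r))" by (rule polyhedral_decomposition_cells)
  fix P assume "P \<in> range (cell r)"
  then obtain y where P: "P = cell r y" by blast
  \<comment> \<open>A selection made at \<open>y\<close> stays valid on its whole cell, so there
    each theta function is the single affine function given by the height of
    \<open>\<sigma> (c i)\<close>.\<close>
  obtain \<sigma> where sel: "nearest_selection (r - y) \<sigma>" and gen: "generates (\<sigma> ` L) L"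
    using ex_generating_selection[OF assms] by blast
  let ?A = "\<lambda>v i. if i < D - 1 then blinfun_apply (blinfun_apply Q v) (\<sigma> (c i) - \<sigma> (c (D - 1))) else 0"
  let ?c = "\<lambda>i. if i < D - 1 then height r (\<sigma> (c i)) 0 - height r (\<sigma> (c (D - 1))) 0 else 0"
  have "unimodular_linear M (D - 1) ?A"
    using sel nearest_subset_L by (intro unimodular_selection gen) (auto simp: nearest_selection_def)
  moreover have "theta_map M' Q l D b (coset M' x) = (\<lambda>i. ?A x i + ?c i)" if x: "x \<in> P" for x
  proof -
    have "class_theta r (c i) x = blinfun_apply (blinfun_apply Q x) (\<sigma> (c i)) + height r (\<sigma> (c i)) 0"
      if "i < D" for i
    proof -
      have "\<sigma> (c i) \<in> nearest (r - x)" "\<sigma> (c i) - c i \<in> M'"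
        using sel x c_in_L[OF that] unfolding P cell_def common_cell_def nearest_selection_def by auto
      then show ?thesis by (simp add: class_theta_eq height_def blinfun.zero_right)
    qed
    then show ?thesis
      unfolding theta_map_coset using D_pos by (auto simp: blinfun.diff_right)
  qed
  ultimately show "\<exists>A c. unimodular_linear M (D - 1) A \<and>
      (\<forall>x\<in>P. theta_map M' Q l D b (coset M' x) = (\<lambda>i. A x i + c i))"
    by (intro exI[of _ ?A] exI[of _ ?c]) simp
qed

end

theorem theorem4p11:
  fixes M :: "('v::euclidean_space \<Rightarrow>\<^sub>L real) set"
    and M' :: "'v set"
    and Q :: "'v \<Rightarrow>\<^sub>L 'v \<Rightarrow>\<^sub>L real"
    and l :: "'v \<Rightarrow> real"
    and d :: "nat \<Rightarrow> nat"
    and n D :: nat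
    and b :: "nat \<Rightarrow> ('v \<Rightarrow>\<^sub>L real)"
  assumes "n = DIM('v)"
    and "full_lattice M"
    and "full_lattice M'"
    and "polarization M M' Q"
    and "polarization_type M M' Q d"
    and "\<And>u v. u \<in> M' \<Longrightarrow> v \<in> M' \<Longrightarrow> l (u + v) = l u + l v"
    and "D = (\<Prod>i=1..n. d i)"
    and "complete_reps M (blinfun_apply Q ` M') D b"
  shows "(d 1 \<ge> 3 \<longrightarrow>
            embedding_map (torus M') (Euclidean_space (D - 1)) (theta_map M' Q l D b)) \<and>
         (d 1 \<ge> 2 * fact (n - 1) \<longrightarrow>
            unimodular M M' (D - 1) (theta_map M' Q l D b)) \<and>
         (d 1 \<ge> max 3 (2 * fact (n - 1)) \<longrightarrow>
            faithful_embedding M M' (D - 1) (theta_map M' Q l D b))"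
proof -
  obtain w e where "lattice_basis DIM('v) w M'" "lattice_basis DIM('v) e M"
    "\<forall>i\<in>{1..DIM('v)}. blinfun_apply Q (w i) = real (d i) *\<^sub>R e i"
    using assms(5) unfolding polarization_type_def by blast
  moreover have "\<forall>i\<in>{1..DIM('v)}. d i > 0" "\<forall>i\<in>{1..<DIM('v)}. d i dvd d (Suc i)"
    using assms(5) unfolding polarization_type_def by blast+
  \<comment> \<open>Positivity makes \<open>D - 1\<close> the last index rather than a truncated
    difference.\<close>
  moreover from this have "D > 0"
    unfolding assms(7) assms(1) by (intro prod_pos) blast
  ultimately interpret polarized_torus_reps M M' Q d w e l D b
    using assms(4,8) by unfold_locales blast+
  show ?thesis
    unfolding faithful_embedding_def assms(1)
    using embedding_theta_map unimodular_theta_map by simp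
qed

end
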